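(* Let $m\ge2$, $n\ge1$ and let $\boldsymbol\alpha$ be a very singular real $m\times n$ matrix. Then the set $\mathcal T\!\mathbf{ad}(\boldsymbol\alpha)$ of badly $\boldsymbol\alpha$-approximable vectors has full measure on every nondegenerate analytic submanifold $\mathcal M$ of $\mathbb R^m$, i.e. $\mathcal M\setminus\mathcal T\!\mathbf{ad}(\boldsymbol\alpha)$ is null for the induced Lebesgue measure on $\mathcal M$.
   Context: $\|\cdot\|$ is the Euclidean norm. An $m\times n$ matrix $\boldsymbol\alpha$ is very singular if there exist $\epsilon>0$ and $Q_\epsilon\ge1$ such that for all $Q\ge Q_\epsilon$ there exists $(\mathbf p,\mathbf q)\in\mathbb Z^m\times\mathbb Z^n$ with $\|\boldsymbol\alpha\mathbf q+\mathbf p\|\le Q^{-(n/m+\epsilon)}$ and $0<\|\mathbf q\|\le Q$. $\mathcal T_\psi(\boldsymbol\alpha)$ is the set of $\boldsymbol\beta\in\mathbb R^m$ for which there are infinitely many $(\mathbf p,\mathbf q)\in\mathbb Z^m\times(\mathbb Z^n\setminus\{\mathbf 0\})$ with $\|\boldsymbol\alpha\mathbf q+\boldsymbol\beta+\mathbf p\|\le\psi(\|\mathbf q\|)$. $\boldsymbol\beta$ is badly $\boldsymbol\alpha$-approximable if $\boldsymbol\beta\notin\mathcal T_\psi(\boldsymbol\alpha)$ for some $\psi(q)=cq^{-n/m}$ with $c>0$; $\mathcal T\!\mathbf{ad}(\boldsymbol\alpha)$ is the set of such $\boldsymbol\beta$. A manifold $\mathcal M\subset\mathbb R^m$ with local parametrization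 $\mathbf f$ is nondegenerate at $\mathbf f(\mathbf x)$ if for some $k$, $\mathbf f$ is $C^k$ and its partial derivatives at $\mathbf x$ of orders $1,\dots,k$ span $\mathbb R^m$; it is nondegenerate if nondegenerate at almost every point. *)

theory Defs
  imports "HOL-Analysis.Analysis"
begin

section \<open>Diophantine approximation\<close>

definition of_int_vec :: "int ^ 'n \<Rightarrow> real ^ 'n" where
  "of_int_vec v = (\<chi> i. of_int (v $ i))"

definition very_singular :: "real ^ 'n ^ 'm \<Rightarrow> bool" where
  "very_singular \<alpha> \<longleftrightarrow>
    (\<exists>\<epsilon>>0. \<exists>Q\<^sub>\<epsilon>\<ge>1. \<forall>Q\<ge>Q\<^sub>\<epsilon>. \<exists>(p :: int ^ 'm) (q :: int ^ 'n).
      norm (\<alpha> *v of_int_vec q + of_int_vec p)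
        \<le> Q powr - (real CARD('n) / real CARD('m) + \<epsilon>) \<and>
      0 < norm (of_int_vec q) \<and> norm (of_int_vec q) \<le> Q)"

definition approximable :: "(real \<Rightarrow> real) \<Rightarrow> real ^ 'n ^ 'm \<Rightarrow> (real ^ 'm) set" where
  "approximable \<psi> \<alpha> = {\<beta>. infinite {(p :: int ^ 'm, q :: int ^ 'n). q \<noteq> 0 \<and>
      norm (\<alpha> *v of_int_vec q + \<beta> + of_int_vec p) \<le> \<psi> (norm (of_int_vec q))}}"

definition badly_approximable :: "real ^ 'n ^ 'm \<Rightarrow> (real ^ 'm) set" where
  "badly_approximable \<alpha> = {\<beta>. \<exists>c>0.
      \<beta> \<notin> approximable (\<lambda>q. c * q powr - (real CARD('n) / real CARD('m))) \<alpha>}"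


section \<open>Analytic submanifolds\<close>

text \<open>The index type \<^typ>\<open>'d \<Rightarrow> nat\<close> below is the set of all multi-indices; the
  sum is unconditional.\<close>

definition real_analytic_on :: "(real ^ 'd \<Rightarrow> real ^ 'm) \<Rightarrow> (real ^ 'd) set \<Rightarrow> bool" where
  "real_analytic_on f U \<longleftrightarrow> (\<forall>x\<in>U. \<exists>r>0. \<exists>a :: ('d \<Rightarrow> nat) \<Rightarrow> real ^ 'm. \<forall>y\<in>ball x r.
      ((\<lambda>k. (\<Prod>i\<in>UNIV. (y $ i - x $ i) ^ k i) *\<^sub>R a k) has_sum f y) UNIV)"

definition local_parametrization ::
  "(real ^ 'm) set \<Rightarrow> (real ^ 'd) set \<Rightarrow> (real ^ 'd \<Rightarrow> real ^ 'm) \<Rightarrow> bool" where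
  "local_parametrization M U f \<longleftrightarrow>
     open U \<and> openin (top_of_set M) (f ` U) \<and> (\<exists>g. homeomorphism U (f ` U) f g) \<and>
     real_analytic_on f U \<and> (\<forall>x\<in>U. \<exists>f'. (f has_derivative f') (at x) \<and> inj f')"

text \<open>Submanifolds are embedded. The dimension is the cardinality of the type argument,
  hence at least 1; a nonempty manifold of dimension 0 has no partial derivatives and is
  never nondegenerate.\<close>

definition analytic_submanifold :: "'d::finite itself \<Rightarrow> (real ^ 'm) set \<Rightarrow> bool" where
  "analytic_submanifold _ M \<longleftrightarrow>
     (\<forall>y\<in>M. \<exists>(U :: (real ^ 'd) set) f. local_parametrization M U f \<and> y \<in> f ` U)"

text \<open>The induced Lebesgue measure of \<open>M\<close>, read in a local parametrization \<open>f\<close>, has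
  density \<open>sqrt (det (J\<^sup>T J))\<close> with respect to Lebesgue measure, where \<open>J\<close> is the Jacobian
  matrix of \<open>f\<close>. A set is null when it is null in every local parametrization.\<close>

definition parametrized_volume ::
  "(real ^ 'd) set \<Rightarrow> (real ^ 'd \<Rightarrow> real ^ 'm) \<Rightarrow> (real ^ 'd) measure" where
  "parametrized_volume U f = density (lebesgue_on U)
     (\<lambda>x. ennreal (sqrt (det (transpose (jacobian f (at x)) ** jacobian f (at x)))))"

definition null_in_manifold ::
  "'d::finite itself \<Rightarrow> (real ^ 'm) set \<Rightarrow> (real ^ 'm) set \<Rightarrow> bool" where
  "null_in_manifold _ M A \<longleftrightarrow>
     (\<forall>(U :: (real ^ 'd) set) f. local_parametrization M U f \<longrightarrow>
        {x \<in> U. f x \<in> A} \<in> null_sets (parametrized_volume U f))"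


section \<open>Nondegeneracy\<close>

definition partial_deriv :: "'d \<Rightarrow> (real ^ 'd \<Rightarrow> real ^ 'm) \<Rightarrow> real ^ 'd \<Rightarrow> real ^ 'm" where
  "partial_deriv i f x = vector_derivative (\<lambda>t. f (x + t *\<^sub>R axis i 1)) (at 0)"

definition iterated_partial ::
  "'d list \<Rightarrow> (real ^ 'd \<Rightarrow> real ^ 'm) \<Rightarrow> real ^ 'd \<Rightarrow> real ^ 'm" where
  "iterated_partial is f = foldr partial_deriv is f"

definition Ck_on :: "nat \<Rightarrow> (real ^ 'd \<Rightarrow> real ^ 'm) \<Rightarrow> (real ^ 'd) set \<Rightarrow> bool" where
  "Ck_on k f U \<longleftrightarrow>
     (\<forall>is. length is \<le> k \<longrightarrow> continuous_on U (iterated_partial is f)) \<and>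
     (\<forall>is i. length is < k \<longrightarrow> (\<forall>x\<in>U.
        (\<lambda>t. iterated_partial is f (x + t *\<^sub>R axis i 1)) differentiable (at (0 :: real))))"

definition nondegenerate_at :: "'d::finite itself \<Rightarrow> (real ^ 'm) set \<Rightarrow> real ^ 'm \<Rightarrow> bool" where
  "nondegenerate_at _ M y \<longleftrightarrow>
     (\<exists>(U :: (real ^ 'd) set) f. local_parametrization M U f \<and> (\<exists>x\<in>U. f x = y \<and>
        (\<exists>k. (\<exists>V. open V \<and> x \<in> V \<and> V \<subseteq> U \<and> Ck_on k f V) \<and>
             span {iterated_partial is f x | is. 1 \<le> length is \<and> length is \<le> k} = UNIV)))"

definition nondegenerate :: "'d::finite itself \<Rightarrow> (real ^ 'm) set \<Rightarrow> bool" where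
  "nondegenerate d M \<longleftrightarrow> null_in_manifold d M {y \<in> M. \<not> nondegenerate_at d M y}"

end

theory Submission
  imports Defs
begin

text \<open>
  A pigeonhole argument transfers very singularity to the transpose of \<open>\<alpha>\<close> and yields integer
  vectors \<open>y\<^sub>j\<close> with \<open>R\<^sub>j\<^sub>-\<^sub>1 < \<parallel>y\<^sub>j\<parallel> \<le> R\<^sub>j\<close>, where \<open>R\<^sub>j\<close> grows doubly exponentially and the
  distance of \<open>\<alpha>\<^sup>T y\<^sub>j\<close> to the integer lattice is at most \<open>R\<^sub>j\<^sub>+\<^sub>1\<close> to the power \<open>-b\<close>, for some
  \<open>b > m/n\<close>. Modulo 1, \<open>y\<^sub>j \<bullet> \<beta>\<close> equals \<open>y\<^sub>j \<bullet> (\<alpha> q + \<beta> + p)\<close> up to \<open>(\<alpha>\<^sup>T y\<^sub>j + x) \<bullet> q\<close>. Hence, if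
  \<open>y\<^sub>j \<bullet> \<beta>\<close> is eventually at distance at least \<open>c \<theta>\<^sup>j\<close> from the integers, then \<open>\<beta>\<close> is badly
  approximable: for given \<open>q\<close> use the first \<open>j\<close> for which the error term is harmless.

  By Borel--Cantelli it remains to bound the measure of the \<open>x\<close> with \<open>y \<bullet> f x\<close> close to an integer
  by a power of the distance, uniformly in large \<open>y\<close>. If that set had large measure, it would contain all
  vertices \<open>x + \<Sum> \<epsilon>\<^sub>i h\<^sub>i e\<^sub>i\<close> of a parallelepiped whose sides have a prescribed order of magnitude.
  The mixed difference of \<open>y \<bullet> f\<close> over them would be close to an integer; by the mean value theorem it is
  the product of the sides times a mixed partial derivative, which nondegeneracy bounds from below
  by a multiple of \<open>\<parallel>y\<parallel>\<close>.
\<close>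

section \<open>Sets where a function is close to an integer\<close>

text \<open>The strict inequality makes \<open>{t. near_int \<delta> t}\<close> open, so that
  sublevel sets of continuous functions are open as well.\<close>

definition near_int :: "real \<Rightarrow> real \<Rightarrow> bool" where
  "near_int \<delta> t \<longleftrightarrow> (\<exists>k::int. \<bar>t - of_int k\<bar> < \<delta>)"

lemma near_int_diff:
  assumes "near_int a s" "near_int b t"
  shows "near_int (a + b) (s - t)"
proof -
  obtain j k :: int where "\<bar>s - of_int j\<bar> < a" "\<bar>t - of_int k\<bar> < b"
    using assms by (auto simp: near_int_def)
  then have "\<bar>(s - t) - of_int (j - k)\<bar> < a + b" by simp
  then show ?thesis unfolding near_int_def by blast
qed

lemma near_int_mono: "near_int a t \<Longrightarrow> a \<le> b \<Longrightarrow> near_int b t"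
  unfolding near_int_def by (meson order_less_le_trans)

text \<open>A nonzero integer has distance at least 1/2 from \<open>t\<close>, hence is no closer to
  \<open>t\<close> than 0 is.\<close>

lemma near_int_small:
  assumes "near_int \<delta> t" "\<bar>t\<bar> \<le> 1/2"
  shows "\<bar>t\<bar> < \<delta>"
proof -
  obtain k :: int where k: "\<bar>t - of_int k\<bar> < \<delta>"
    using assms by (auto simp: near_int_def)
  show ?thesis
  proof (cases "k = 0")
    case False
    then have "\<bar>real_of_int k\<bar> \<ge> 1"
      using of_int_leD by fastforce
    then show ?thesis using k assms(2) by linarith
  qed (use k in simp)
qed

lemma lmeasurable_near_int_sublevel:
  fixes F :: "'a::euclidean_space \<Rightarrow> real"
  assumes "continuous_on (ball x0 r) F"
  shows "{x \<in> ball x0 r. near_int \<delta> (F x)} \<in> lmeasurable"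
proof -
  have "open {t. near_int \<delta> t}"
    by (auto simp: near_int_def Collect_ex_eq intro!: open_UN open_Collect_less continuous_intros)
  then have "open (ball x0 r \<inter> F -` {t. near_int \<delta> t})"
    using assms by (intro continuous_open_preimage) auto
  moreover have "{x \<in> ball x0 r. near_int \<delta> (F x)} = ball x0 r \<inter> F -` {t. near_int \<delta> t}" by auto
  moreover have "bounded {x \<in> ball x0 r. near_int \<delta> (F x)}"
    by (rule bounded_subset[OF bounded_ball[of x0 r]]) auto
  ultimately show ?thesis by (metis lmeasurable_open)
qed

section \<open>Mixed differences and the mean value theorem\<close>

fun mixed_diff :: "('d \<times> real) list \<Rightarrow> (real ^ 'd \<Rightarrow> real) \<Rightarrow> real ^ 'd \<Rightarrow> real" where
  "mixed_diff [] F = F"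
| "mixed_diff ((i, h) # hs) F = mixed_diff hs (\<lambda>x. F (x + h *\<^sub>R axis i 1) - F x)"

text \<open>The defining recursion differences the function first, as the measure argument needs.
  This form takes the same difference last, so that the mean value theorem applies to it in the
  single direction \<open>i\<close>.\<close>

lemma mixed_diff_Cons:
  "mixed_diff ((i, h) # hs) F x = mixed_diff hs F (x + h *\<^sub>R axis i 1) - mixed_diff hs F x"
proof (induction hs arbitrary: F)
  case (Cons a hs)
  obtain j s where a: "a = (j, s)" by (cases a)
  have "mixed_diff ((i, h) # a # hs) F x =
      mixed_diff ((i, h) # hs) (\<lambda>x. F (x + s *\<^sub>R axis j 1) - F x) x"
    by (simp add: a algebra_simps)
  then show ?case
    unfolding Cons.IH by (simp add: a)
qed simp

declare mixed_diff.simps(2) [simp del]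

text \<open>Only the values at the vertices of the parallelepiped with corner \<open>x\<close>
  enter, and these lie in the closed ball whose radius is the sum of the sides.\<close>

lemma mixed_diff_has_derivative:
  assumes "\<And>z. z \<in> cball x (\<Sum>(i, h)\<leftarrow>hs. h) \<Longrightarrow>
      ((\<lambda>t. F (z + t *\<^sub>R axis j 1)) has_real_derivative F' z) (at 0)"
    and "\<And>i h. (i, h) \<in> set hs \<Longrightarrow> h \<ge> 0"
  shows "((\<lambda>t. mixed_diff hs F (x + t *\<^sub>R axis j 1)) has_real_derivative mixed_diff hs F' x) (at 0)"
  using assms
proof (induction hs arbitrary: x)
  case (Cons a hs)
  obtain i h where a: "a = (i, h)" by (cases a)
  have h: "h \<ge> 0" using Cons.prems(2) a by auto
  have 1: "((\<lambda>t. mixed_diff hs F (x + t *\<^sub>R axis j 1)) has_real_derivative mixed_diff hs F' x) (at 0)"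
    using Cons.prems h by (intro Cons.IH) (auto simp: a)
  have "((\<lambda>t. mixed_diff hs F ((x + h *\<^sub>R axis i 1) + t *\<^sub>R axis j 1)) has_real_derivative
      mixed_diff hs F' (x + h *\<^sub>R axis i 1)) (at 0)"
  proof (intro Cons.IH Cons.prems(1))
    fix z assume "z \<in> cball (x + h *\<^sub>R axis i 1) (\<Sum>(i, h)\<leftarrow>hs. h)"
    moreover have "dist x z \<le> dist x (x + h *\<^sub>R axis i 1) + dist (x + h *\<^sub>R axis i 1) z"
      by (rule dist_triangle)
    moreover have "dist x (x + h *\<^sub>R axis i 1) = h"
      using h by (simp add: dist_norm)
    ultimately show "z \<in> cball x (\<Sum>(i, h)\<leftarrow>a # hs. h)" by (simp add: a)
  qed (use Cons.prems(2) in auto)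
  from DERIV_diff[OF this 1] show ?case
    unfolding a mixed_diff_Cons by (simp add: algebra_simps)
qed simp

text \<open>\<open>G\<close> abstracts a family of iterated partial derivatives. The mean value
  theorem is applied to one side at a time; each application pushes its direction in front of
  \<open>js\<close>, which is why the directions come out reversed.\<close>

lemma mixed_diff_mvt:
  fixes G :: "'d::finite list \<Rightarrow> real ^ 'd \<Rightarrow> real"
  assumes "\<And>js i z. length js < k \<Longrightarrow> z \<in> W \<Longrightarrow>
      ((\<lambda>t. G js (z + t *\<^sub>R axis i 1)) has_real_derivative G (i # js) z) (at 0)"
    and "\<And>i h. (i, h) \<in> set hs \<Longrightarrow> h > 0"
    and "cball x (\<Sum>(i, h)\<leftarrow>hs. h) \<subseteq> W"
    and "length js + length hs \<le> k"
  shows "\<exists>\<xi>\<in>cball x (\<Sum>(i, h)\<leftarrow>hs. h). mixed_diff hs (G js) x = (\<Prod>(i, h)\<leftarrow>hs. h) * G (rev (map fst hs) @ js) \<xi>"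
  using assms(2-)
proof (induction hs arbitrary: x js)
  case Nil
  then show ?case by (auto intro!: bexI[of _ x])
next
  case (Cons a hs)
  obtain i h where a: "a = (i, h)" by (cases a)
  have h: "h > 0" using Cons.prems(1) a by auto
  let ?D = "\<lambda>t. mixed_diff hs (G js) (x + t *\<^sub>R axis i 1)"
  have sub: "cball (x + t *\<^sub>R axis i 1) (\<Sum>(i, h)\<leftarrow>hs. h) \<subseteq> cball x (\<Sum>(i, h)\<leftarrow>a # hs. h)"
    if "0 \<le> t" "t \<le> h" for t
  proof
    fix z assume "z \<in> cball (x + t *\<^sub>R axis i 1) (\<Sum>(i, h)\<leftarrow>hs. h)"
    moreover have "dist x z \<le> dist x (x + t *\<^sub>R axis i 1) + dist (x + t *\<^sub>R axis i 1) z"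
      by (rule dist_triangle)
    moreover have "dist x (x + t *\<^sub>R axis i 1) = t"
      using that by (simp add: dist_norm)
    ultimately show "z \<in> cball x (\<Sum>(i, h)\<leftarrow>a # hs. h)" using that by (simp add: a)
  qed
  have D: "(?D has_real_derivative mixed_diff hs (G (i # js)) (x + t *\<^sub>R axis i 1)) (at t)"
    if "0 \<le> t" "t \<le> h" for t
  proof -
    have "((\<lambda>s. mixed_diff hs (G js) ((x + t *\<^sub>R axis i 1) + s *\<^sub>R axis i 1)) has_real_derivative
        mixed_diff hs (G (i # js)) (x + t *\<^sub>R axis i 1)) (at 0)"
    proof (rule mixed_diff_has_derivative)
      fix z assume z: "z \<in> cball (x + t *\<^sub>R axis i 1) (\<Sum>(i, h)\<leftarrow>hs. h)"
      have "z \<in> W" using z sub[OF that] Cons.prems(2) by blast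
      then show "((\<lambda>t. G js (z + t *\<^sub>R axis i 1)) has_real_derivative G (i # js) z) (at 0)"
        using Cons.prems(3) by (intro assms(1)) auto
    next
      show "h' \<ge> 0" if "(i', h') \<in> set hs" for i' h'
        using Cons.prems(1)[of i' h'] that by auto
    qed
    then have "((\<lambda>s. ?D (s + t)) has_real_derivative
        mixed_diff hs (G (i # js)) (x + t *\<^sub>R axis i 1)) (at 0)"
      by (simp add: algebra_simps)
    then show ?thesis
      using DERIV_shift[of ?D _ 0 t] by simp
  qed
  from MVT2[OF h D] obtain t where t: "0 < t" "t < h"
    and eq: "?D h - ?D 0 = (h - 0) * mixed_diff hs (G (i # js)) (x + t *\<^sub>R axis i 1)"
    by auto
  have "\<exists>\<xi>\<in>cball (x + t *\<^sub>R axis i 1) (\<Sum>(i, h)\<leftarrow>hs. h).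
     mixed_diff hs (G (i # js)) (x + t *\<^sub>R axis i 1) =
      (\<Prod>(i, h)\<leftarrow>hs. h) * G (rev (map fst hs) @ i # js) \<xi>"
  proof (rule Cons.IH)
    show "cball (x + t *\<^sub>R axis i 1) (\<Sum>(i, h)\<leftarrow>hs. h) \<subseteq> W"
      using sub[of t] t Cons.prems(2) by auto
  qed (use Cons.prems in auto)
  then obtain \<xi> where "\<xi> \<in> cball (x + t *\<^sub>R axis i 1) (\<Sum>(i, h)\<leftarrow>hs. h)"
    and \<xi>: "mixed_diff hs (G (i # js)) (x + t *\<^sub>R axis i 1) =
      (\<Prod>(i, h)\<leftarrow>hs. h) * G (rev (map fst hs) @ i # js) \<xi>" by blast
  then have "\<xi> \<in> cball x (\<Sum>(i, h)\<leftarrow>a # hs. h)"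
    using sub[of t] t by auto
  moreover have "mixed_diff (a # hs) (G js) x =
      (\<Prod>(i, h)\<leftarrow>a # hs. h) * G (rev (map fst (a # hs)) @ js) \<xi>"
    unfolding a mixed_diff_Cons using eq \<xi> by simp
  ultimately show ?case by blast
qed

section \<open>Overlapping translates of a set of positive measure\<close>

text \<open>A Bonferroni inequality: adding one set costs at most its overlaps with the earlier
  ones.\<close>

lemma sum_measure_le_union_plus_overlaps:
  fixes S :: "nat \<Rightarrow> 'a set"
  assumes "\<And>j. S j \<in> fmeasurable M"
  shows "(\<Sum>j<n. measure M (S j)) \<le>
    measure M (\<Union>j<n. S j) + (\<Sum>j<n. \<Sum>i<j. measure M (S i \<inter> S j))"
proof (induction n)
  case (Suc n)
  have U: "(\<Union>j<n. S j) \<in> fmeasurable M"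
    using assms by (intro fmeasurable.finite_UN) auto
  have "measure M (\<Union>j<Suc n. S j) =
      measure M (\<Union>j<n. S j) + measure M (S n) - measure M ((\<Union>j<n. S j) \<inter> S n)"
    using measure_Un3[OF U assms[of n]] by (simp add: lessThan_Suc Un_commute)
  moreover have "measure M ((\<Union>j<n. S j) \<inter> S n) \<le> (\<Sum>i<n. measure M (S i \<inter> S n))"
  proof -
    have "(\<Union>j<n. S j) \<inter> S n = (\<Union>j<n. S j \<inter> S n)" by auto
    then show ?thesis
      using measure_UNION_le[of "{..<n}" "\<lambda>j. S j \<inter> S n" M] assms
      by (simp add: fmeasurableD sets.Int)
  qed
  ultimately show ?case using Suc.IH by simp
qed simp

lemma lmeasurable_vimage_translation:
  fixes A :: "'a::euclidean_space set"
  assumes "A \<in> lmeasurable"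
  shows "{x \<in> A. x + v \<in> A} \<in> lmeasurable"
proof -
  have "{x \<in> A. x + v \<in> A} = A \<inter> (+) (- v) ` A"
    by (auto intro!: image_eqI[of _ _ "_ + v"])
  then show ?thesis using assms measurable_translation[OF assms, of "- v"] by auto
qed

text \<open>The \<open>J\<close> translates of \<open>A\<close> by multiples of \<open>\<tau> e\<close> lie in a ball
  too small for them to be nearly disjoint.\<close>

lemma translate_overlap:
  fixes A :: "'a::euclidean_space set"
  assumes A: "A \<in> lmeasurable" "A \<subseteq> ball x0 r" and \<rho>: "0 < \<rho>" "\<rho> \<le> measure lebesgue A"
    and e: "norm e \<le> 1" and \<tau>: "0 < \<tau>" "real J * \<tau> \<le> r"
    and J: "real J * \<rho> \<ge> 2 * measure lebesgue (ball x0 (2 * r))" "J > 0"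
  shows "\<exists>a\<in>{1..J}. measure lebesgue {x \<in> A. x + (real a * \<tau>) *\<^sub>R e \<in> A} \<ge> \<rho> / (4 * J)"
proof (rule ccontr)
  assume "\<not> ?thesis"
  then have less: "measure lebesgue {x \<in> A. x + (real a * \<tau>) *\<^sub>R e \<in> A} < \<rho> / (4 * J)"
    if "a \<in> {1..J}" for a
    using that by force
  define S where "S j = (+) ((real j * \<tau>) *\<^sub>R e) ` A" for j :: nat
  have S: "S j \<in> lmeasurable" for j
    unfolding S_def by (rule measurable_translation[OF A(1)])
  have mS: "measure lebesgue (S j) = measure lebesgue A" for j
    unfolding S_def by (rule measure_translation)
  have ov: "measure lebesgue (S i \<inter> S j) \<le> \<rho> / (4 * J)" if "i < j" "j < J" for i j
  proof -
    \<comment> \<open>The overlap is a translate of the set of points of \<open>A\<close> that stay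
      in \<open>A\<close> under the shift by \<open>j - i\<close> steps, and
      \<open>1 \<le> j - i \<le> J\<close>, so \<open>less\<close> applies.\<close>
    have "S i \<inter> S j = (+) ((real j * \<tau>) *\<^sub>R e) ` {x \<in> A. x + (real (j - i) * \<tau>) *\<^sub>R e \<in> A}"
    proof -
      have 1: "y \<in> A \<longleftrightarrow> x + (real (j - i) * \<tau>) *\<^sub>R e \<in> A"
        if "(real i * \<tau>) *\<^sub>R e + y = (real j * \<tau>) *\<^sub>R e + x" for x y
      proof -
        have "y = x + (real (j - i) * \<tau>) *\<^sub>R e"
          using that \<open>i < j\<close> by (simp add: of_nat_diff algebra_simps)
        then show ?thesis by simp
      qed
      have 2: "(real j * \<tau>) *\<^sub>R e + x = (real i * \<tau>) *\<^sub>R e + (x + (real (j - i) * \<tau>) *\<^sub>R e)" for x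
        using \<open>i < j\<close> by (simp add: of_nat_diff algebra_simps)
      show ?thesis
        unfolding S_def
      proof (intro subset_antisym subsetI; elim IntE imageE)
        fix x y z assume "x \<in> A" "z \<in> A" "y = (real i * \<tau>) *\<^sub>R e + x" "y = (real j * \<tau>) *\<^sub>R e + z"
        then show "y \<in> (+) ((real j * \<tau>) *\<^sub>R e) ` {x \<in> A. x + (real (j - i) * \<tau>) *\<^sub>R e \<in> A}"
          using 1[of x z] by (auto intro!: image_eqI[of _ _ z])
      next
        fix y x assume "y = (real j * \<tau>) *\<^sub>R e + x" "x \<in> {x \<in> A. x + (real (j - i) * \<tau>) *\<^sub>R e \<in> A}"
        then show "y \<in> (+) ((real i * \<tau>) *\<^sub>R e) ` A \<inter> (+) ((real j * \<tau>) *\<^sub>R e) ` A"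
          using 2[of x] by auto
      qed
    qed
    then have "measure lebesgue (S i \<inter> S j) =
        measure lebesgue {x \<in> A. x + (real (j - i) * \<tau>) *\<^sub>R e \<in> A}"
      by (simp only: measure_translation)
    also have "\<dots> \<le> \<rho> / (4 * J)"
    proof -
      have "j - i \<in> {1..J}" using that by auto
      from less[OF this] show ?thesis by (rule less_imp_le)
    qed
    finally show ?thesis .
  qed
  \<comment> \<open>All shifts have length at most \<open>J * \<tau> \<le> r\<close>.\<close>
  have "S j \<subseteq> ball x0 (2 * r)" if "j < J" for j
  proof
    fix y assume "y \<in> S j"
    then obtain x where x: "x \<in> A" "y = (real j * \<tau>) *\<^sub>R e + x" by (auto simp: S_def)
    have "norm ((real j * \<tau>) *\<^sub>R e) \<le> real j * \<tau> * 1"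
      using e \<tau> by (simp add: mult_left_le)
    also have "\<dots> \<le> r" using that \<tau> by (smt (verit) mult_right_mono of_nat_less_iff)
    finally have "dist x y \<le> r" using x by (simp add: dist_norm)
    moreover have "dist x0 x < r" using x A by auto
    ultimately show "y \<in> ball x0 (2 * r)" using dist_triangle[of x0 y x] by simp
  qed
  then have "measure lebesgue (\<Union>j<J. S j) \<le> measure lebesgue (ball x0 (2 * r))"
    using S by (intro measure_mono_fmeasurable) (auto intro!: sets.finite_UN fmeasurableD)
  \<comment> \<open>The translates have total measure at least \<open>J * \<rho>\<close>, whereas
    the ball contributes at most \<open>J * \<rho> / 2\<close> and the overlaps at most
    \<open>J * \<rho> / 4\<close>.\<close>
  moreover have "(\<Sum>j<J. \<Sum>i<j. measure lebesgue (S i \<inter> S j)) \<le> (\<Sum>j<J. \<Sum>i<J. \<rho> / (4 * J))"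
  proof (intro sum_mono)
    fix j assume "j \<in> {..<J}"
    then have "(\<Sum>i<j. measure lebesgue (S i \<inter> S j)) \<le> (\<Sum>i<j. \<rho> / (4 * J))"
      using ov by (intro sum_mono) auto
    also have "\<dots> \<le> (\<Sum>i<J. \<rho> / (4 * J))"
      using \<open>j \<in> {..<J}\<close> \<rho> by (intro sum_mono2) auto
    finally show "(\<Sum>i<j. measure lebesgue (S i \<inter> S j)) \<le> (\<Sum>i<J. \<rho> / (4 * J))" .
  qed
  moreover have "(\<Sum>j<J. \<Sum>i<J. \<rho> / (4 * J)) = J * \<rho> / 4"
    using J(2) by (simp add: field_simps)
  moreover have "(\<Sum>j<J. measure lebesgue (S j)) \<ge> J * \<rho>"
    using \<rho> J(2) by (simp add: mS)
  moreover have "J * \<rho> > 0" using J \<rho> by simp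
  moreover have "(\<Sum>j<J. measure lebesgue (S j)) \<le>
      measure lebesgue (\<Union>j<J. S j) + (\<Sum>j<J. \<Sum>i<j. measure lebesgue (S i \<inter> S j))"
    by (rule sum_measure_le_union_plus_overlaps[OF S])
  ultimately show False
    using J(1) by linarith
qed

text \<open>Each step intersects the set with a translate of itself in the next coordinate direction,
  keeping a polynomial proportion of its measure, so that after \<open>l\<close> steps some configuration
  of \<open>2 ^ l\<close> points remains in the set.\<close>

lemma near_int_mixed_diff:
  fixes x0 :: "real ^ 'd"
  shows "\<exists>C\<ge>1. \<exists>s::nat. \<forall>\<rho> \<tau> A is F \<delta>. length is = l \<longrightarrow> 0 < \<rho> \<longrightarrow> \<rho> \<le> 1 \<longrightarrow> 0 < \<tau> \<longrightarrow>
    C * (1/\<rho>)^s * \<tau> \<le> r \<longrightarrow> A \<in> lmeasurable \<longrightarrow> A \<subseteq> ball x0 r \<longrightarrow> \<rho> \<le> measure lebesgue A \<longrightarrow>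
    (\<forall>x\<in>A. near_int \<delta> (F x)) \<longrightarrow>
    (\<exists>hs x. map fst hs = is \<and> (\<forall>(i, h)\<in>set hs. \<tau> \<le> h \<and> h \<le> C * (1/\<rho>)^s * \<tau>) \<and>
       x \<in> ball x0 r \<and> near_int (2^l * \<delta>) (mixed_diff hs F x))"
proof (induction l)
  case 0
  show ?case
  proof (intro exI[of _ "1::real"] conjI exI[of _ "0::nat"] allI impI)
    fix \<rho> \<tau> \<delta> :: real and A and "is" :: "'d list" and F
    assume "length is = 0" "0 < \<rho>" "\<rho> \<le> measure lebesgue A" "A \<subseteq> ball x0 r"
      and *: "\<forall>x\<in>A. near_int \<delta> (F x)"
    have "A \<noteq> {}" using \<open>0 < \<rho>\<close> \<open>\<rho> \<le> measure lebesgue A\<close> by auto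
    then obtain x where "x \<in> A" by blast
    then show "\<exists>hs x. map fst hs = is \<and> (\<forall>(i, h)\<in>set hs. \<tau> \<le> h \<and> h \<le> 1 * (1/\<rho>)^0 * \<tau>) \<and>
       x \<in> ball x0 r \<and> near_int (2^0 * \<delta>) (mixed_diff hs F x)"
      using * \<open>length is = 0\<close> \<open>A \<subseteq> ball x0 r\<close>
      by (intro exI[of _ "[]"] exI[of _ x]) auto
  qed simp
next
  case (Suc l)
  then obtain C s where C: "C \<ge> 1" and IH0: "\<forall>\<rho> \<tau> A is F \<delta>. length is = l \<longrightarrow> 0 < \<rho> \<longrightarrow> \<rho> \<le> 1 \<longrightarrow> 0 < \<tau> \<longrightarrow>
    C * (1/\<rho>)^s * \<tau> \<le> r \<longrightarrow> A \<in> lmeasurable \<longrightarrow> A \<subseteq> ball x0 r \<longrightarrow> \<rho> \<le> measure lebesgue A \<longrightarrow>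
    (\<forall>x\<in>A. near_int \<delta> (F x)) \<longrightarrow>
    (\<exists>hs x. map fst hs = is \<and> (\<forall>(i, h)\<in>set hs. \<tau> \<le> h \<and> h \<le> C * (1/\<rho>)^s * \<tau>) \<and>
       x \<in> ball x0 r \<and> near_int (2^l * \<delta>) (mixed_diff hs F x))"
    by blast
  note IH = IH0[rule_format]
  define V where "V = measure lebesgue (ball x0 (2 * r))"
  have V: "V \<ge> 0" by (simp add: V_def)
  \<comment> \<open>One step replaces \<open>\<rho>\<close> by
    \<open>\<rho>' = \<rho>^2 / (8 * V + 8)\<close>, which turns \<open>s\<close> into
    \<open>2 * s\<close> and produces the factor \<open>(8 * V + 8)^s\<close>. The summand
    \<open>2 * V + 2\<close> and the extra power of \<open>1 / \<rho>\<close> bound the number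
    \<open>J\<close> of translates.\<close>
  define C' where "C' = C * (8 * V + 8)^s + 2 * V + 2"
  define s' where "s' = 2 * s + 1"
  have C'1: "C' \<ge> 1" using C V by (simp add: C'_def add_nonneg_nonneg)
  show ?case
  proof (intro exI[of _ C'] conjI exI[of _ s'] allI impI C'1)
    fix \<rho> \<tau> \<delta> :: real and A and "is" :: "'d list" and F
    assume len: "length is = Suc l" and \<rho>: "0 < \<rho>" "\<rho> \<le> 1" and \<tau>: "0 < \<tau>" "C' * (1/\<rho>)^s' * \<tau> \<le> r"
      and A: "A \<in> lmeasurable" "A \<subseteq> ball x0 r" "\<rho> \<le> measure lebesgue A"
      and near: "\<forall>x\<in>A. near_int \<delta> (F x)"
    obtain i is' where is': "is = i # is'" "length is' = l"
      using len by (cases "is") auto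
    \<comment> \<open>Enough translates for \<open>translate_overlap\<close>, which needs
      \<open>J * \<rho> \<ge> 2 * V\<close>.\<close>
    define J where "J = nat \<lceil>2 * V / \<rho>\<rceil> + 1"
    have J0: "J > 0" by (simp add: J_def)
    have J1: "real J \<ge> 2 * V / \<rho>" unfolding J_def by linarith
    then have J1': "real J * \<rho> \<ge> 2 * V" using \<rho> by (simp add: field_simps)
    have "real J \<le> 2 * V / \<rho> + 2"
    proof -
      have "2 * V / \<rho> \<ge> 0" using V \<rho> by simp
      then show ?thesis unfolding J_def by linarith
    qed
    also have "\<dots> \<le> (2 * V + 2) * (1/\<rho>)" using \<rho> by (simp add: field_simps)
    finally have J2: "real J \<le> (2 * V + 2) * (1/\<rho>)" .
    have r1: "1/\<rho> \<ge> 1" using \<rho> by simp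
    have p1: "1/\<rho> \<le> (1/\<rho>)^s'" unfolding s'_def using r1 
      by (metis le_add2 power_increasing power_one_right)
    have p2: "(1/\<rho>)^(2 * s) \<le> (1/\<rho>)^s'" unfolding s'_def by (rule power_increasing) (use r1 in auto)
    have JC: "real J \<le> C' * (1/\<rho>)^s'"
    proof -
      have "(2 * V + 2) * (1/\<rho>) \<le> C' * (1/\<rho>)^s'"
        using p1 V C r1 \<rho> by (intro mult_mono) (auto simp: C'_def)
      then show ?thesis using J2 by linarith
    qed
    have J\<tau>: "real J * \<tau> \<le> r"
      using mult_right_mono[OF JC, of \<tau>] \<tau> by linarith
    obtain a where a: "a \<in> {1..J}"
      and ma: "measure lebesgue {x \<in> A. x + (real a * \<tau>) *\<^sub>R axis i 1 \<in> A} \<ge> \<rho> / (4 * J)"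
      using translate_overlap[OF A(1,2) \<rho>(1) A(3) _ \<tau>(1) J\<tau>, of "axis i 1"] J1' J0
      unfolding V_def by auto
    define h where "h = real a * \<tau>"
    define A' where "A' = {x \<in> A. x + h *\<^sub>R axis i 1 \<in> A}"
    \<comment> \<open>The overlap has measure at least \<open>\<rho> / (4 * J)\<close>; inserting
      \<open>J \<le> (2 * V + 2) / \<rho>\<close> makes the bound depend on \<open>\<rho>\<close>
      alone.\<close>
    define \<rho>' where "\<rho>' = \<rho>^2 / (8 * V + 8)"
    have \<rho>': "0 < \<rho>'" "\<rho>' \<le> 1" 
    proof -
      show "0 < \<rho>'" using \<rho> V by (simp add: \<rho>'_def add_nonneg_pos)
      have "\<rho>^2 \<le> 1" using \<rho> by (simp add: power_le_one)
      then have "\<rho>^2 \<le> 8 * V + 8" using V by linarith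
      then show "\<rho>' \<le> 1" using V by (simp add: \<rho>'_def)
    qed
    have "\<rho>' \<le> \<rho> / (4 * J)"
    proof -
      have "\<rho> * real J \<le> 2 * V + 2" using J2 \<rho> by (simp add: field_simps)
      then have "\<rho>^2 * (4 * real J) \<le> \<rho> * (8 * V + 8)"
        using \<rho> by (simp add: power2_eq_square)
      then show ?thesis
        unfolding \<rho>'_def using J0 V \<rho> by (simp add: divide_simps)
    qed
    then have mA': "\<rho>' \<le> measure lebesgue A'" using ma by (simp add: A'_def h_def)
    have bound: "C * (1/\<rho>')^s \<le> C' * (1/\<rho>)^s'"
    proof -
      have "C * (1/\<rho>')^s = C * (8 * V + 8)^s * (1/\<rho>)^(2 * s)"
        by (simp add: \<rho>'_def power_divide power_mult)
      also have "\<dots> \<le> C' * (1/\<rho>)^s'"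
        using p2 V C C'1 \<rho> by (intro mult_mono) (auto simp: C'_def)
      finally show ?thesis .
    qed
    then have bound\<tau>: "C * (1/\<rho>')^s * \<tau> \<le> C' * (1/\<rho>)^s' * \<tau>"
      using \<tau> by (intro mult_right_mono) auto
    \<comment> \<open>On \<open>A'\<close> both \<open>F x\<close> and
      \<open>F (x + h *\<^sub>R axis i 1)\<close> are close to integers, so the induction hypothesis
      applies to their difference, with tolerance \<open>2 * \<delta>\<close>.\<close>
    have "\<exists>hs x. map fst hs = is' \<and> (\<forall>(i, h)\<in>set hs. \<tau> \<le> h \<and> h \<le> C * (1/\<rho>')^s * \<tau>) \<and>
       x \<in> ball x0 r \<and> near_int (2^l * (2 * \<delta>)) (mixed_diff hs (\<lambda>x. F (x + h *\<^sub>R axis i 1) - F x) x)"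
    proof (rule IH[OF is'(2) \<rho>' \<tau>(1) _ _ _ mA'])
      show "A' \<in> lmeasurable" unfolding A'_def by (rule lmeasurable_vimage_translation[OF A(1)])
      show "A' \<subseteq> ball x0 r" using A by (auto simp: A'_def)
      show "near_int (2 * \<delta>) (F (x + h *\<^sub>R axis i 1) - F x)" if "x \<in> A'" for x
      proof -
        have "near_int \<delta> (F (x + h *\<^sub>R axis i 1))" "near_int \<delta> (F x)"
          using near that by (auto simp: A'_def)
        from near_int_diff[OF this] show ?thesis by simp
      qed
      show "C * (1/\<rho>')^s * \<tau> \<le> r" using bound\<tau> \<tau>(2) by linarith
    qed
    then obtain hs x where hs: "map fst hs = is'" "\<forall>(i, h)\<in>set hs. \<tau> \<le> h \<and> h \<le> C * (1/\<rho>')^s * \<tau>"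
      and x: "x \<in> ball x0 r" "near_int (2^l * (2 * \<delta>)) (mixed_diff hs (\<lambda>x. F (x + h *\<^sub>R axis i 1) - F x) x)"
      by blast
    have "\<tau> \<le> h" using a \<tau> by (simp add: h_def)
    moreover have "h \<le> C' * (1/\<rho>)^s' * \<tau>"
    proof -
      have "h \<le> real J * \<tau>" using a \<tau> by (simp add: h_def)
      then show ?thesis using mult_right_mono[OF JC, of \<tau>] \<tau> by linarith
    qed
    ultimately have "\<forall>(i, h)\<in>set ((i, h) # hs). \<tau> \<le> h \<and> h \<le> C' * (1/\<rho>)^s' * \<tau>"
      using hs(2) bound\<tau> by fastforce
    then show "\<exists>hs x. map fst hs = is \<and> (\<forall>(i, h)\<in>set hs. \<tau> \<le> h \<and> h \<le> C' * (1/\<rho>)^s' * \<tau>) \<and>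
       x \<in> ball x0 r \<and> near_int (2^Suc l * \<delta>) (mixed_diff hs F x)"
      using hs(1) is'(1) x
      by (intro exI[of _ "(i, h) # hs"] exI[of _ x]) (auto simp: mixed_diff.simps(2) mult_ac)
  qed
qed

section \<open>The sublevel estimate when one partial derivative dominates\<close>

lemma prod_list_snd_bounds:
  fixes hs :: "('a \<times> real) list"
  assumes "\<forall>(i, h)\<in>set hs. a \<le> h \<and> h \<le> b" "0 \<le> a"
  shows "a ^ length hs \<le> (\<Prod>(i, h)\<leftarrow>hs. h)" "(\<Prod>(i, h)\<leftarrow>hs. h) \<le> b ^ length hs"
proof -
  have "a ^ length hs \<le> (\<Prod>(i, h)\<leftarrow>hs. h) \<and> (\<Prod>(i, h)\<leftarrow>hs. h) \<le> b ^ length hs"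
    using assms(1)
  proof (induction hs)
    case (Cons p hs)
    obtain i h where p: "p = (i, h)" by (cases p)
    have IH: "a ^ length hs \<le> (\<Prod>(i, h)\<leftarrow>hs. h)" "(\<Prod>(i, h)\<leftarrow>hs. h) \<le> b ^ length hs"
      and h: "a \<le> h" "h \<le> b"
      using Cons p by auto
    have "0 \<le> a ^ length hs" using assms(2) by simp
    then show ?case
      using IH h assms(2) order_trans[OF _ IH(1), of 0] by (auto simp: p intro!: mult_mono)
  qed simp
  then show "a ^ length hs \<le> (\<Prod>(i, h)\<leftarrow>hs. h)" "(\<Prod>(i, h)\<leftarrow>hs. h) \<le> b ^ length hs"
    by auto
qed

lemma sum_list_snd_le:
  fixes hs :: "('a \<times> real) list"
  assumes "\<forall>(i, h)\<in>set hs. h \<le> b"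
  shows "(\<Sum>(i, h)\<leftarrow>hs. h) \<le> real (length hs) * b"
  using assms by (induction hs) (auto simp: algebra_simps)

text \<open>The constants depend only on the ball, \<open>l\<close>, \<open>c0\<close> and
  \<open>K\<close>. With \<open>G js\<close> the inner product of \<open>y\<close> and an iterated
  partial, and \<open>N = norm y\<close>, this becomes an estimate uniform in
  \<open>y\<close>.\<close>

lemma near_int_sublevel_measure:
  fixes x0 :: "real ^ 'd::finite"
  assumes r: "r > 0" and l: "l \<ge> 1" and c0: "c0 > 0" and K: "K > 0"
  shows "\<exists>N0>0. \<exists>c>0. \<exists>s::nat. \<forall>G N is \<rho>.
    (\<forall>js i z. length js < l \<longrightarrow> z \<in> ball x0 (2 * r) \<longrightarrow>
      ((\<lambda>t. G js (z + t *\<^sub>R axis i 1)) has_real_derivative G (i # js) z) (at 0)) \<longrightarrow>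
    continuous_on (ball x0 (2 * r)) (G []) \<longrightarrow> length is = l \<longrightarrow>
    (\<forall>z\<in>ball x0 (2 * r). c0 * N \<le> \<bar>G is z\<bar> \<and> \<bar>G is z\<bar> \<le> K * N) \<longrightarrow>
    N0 \<le> N \<longrightarrow> 0 < \<rho> \<longrightarrow> \<rho> \<le> 1 \<longrightarrow>
    measure lebesgue {x \<in> ball x0 r. near_int (c * \<rho>^s) (G [] x)} < \<rho>"
proof -
  obtain C s where C: "C \<ge> 1"
    and "\<forall>\<rho> \<tau> A is F \<delta>. length is = l \<longrightarrow> 0 < \<rho> \<longrightarrow> \<rho> \<le> 1 \<longrightarrow> 0 < \<tau> \<longrightarrow>
    C * (1/\<rho>)^s * \<tau> \<le> r \<longrightarrow> A \<in> lmeasurable \<longrightarrow> A \<subseteq> ball x0 r \<longrightarrow> \<rho> \<le> measure lebesgue A \<longrightarrow>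
    (\<forall>x\<in>A. near_int \<delta> (F x)) \<longrightarrow>
    (\<exists>hs x. map fst hs = is \<and> (\<forall>(i, h)\<in>set hs. \<tau> \<le> h \<and> h \<le> C * (1/\<rho>)^s * \<tau>) \<and>
       x \<in> ball x0 r \<and> near_int (2^l * \<delta>) (mixed_diff hs F x))"
    using near_int_mixed_diff[of l r x0] by blast
  note near = this(2)[rule_format]
  \<comment> \<open>\<open>N0\<close> ensures \<open>l * (P * \<tau>) \<le> r\<close>, so that the
    parallelepiped stays in the larger ball. \<open>c\<close> is solved from
    \<open>2^l * (c * \<rho>^(s * l)) = \<tau>^l * (c0 * N)\<close>, which makes the final
    contradiction exact.\<close>
  define N0 where "N0 = (real l / r)^l / (2 * K) + 1"
  define c where "c = c0 / (2 * K * C^l * 2^l)"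
  have N0: "N0 > 0" using r K by (simp add: N0_def add_nonneg_pos)
  have c: "c > 0" using C c0 K by (simp add: c_def)
  show ?thesis
  proof (rule exI[of _ N0], rule conjI[OF N0], rule exI[of _ c], rule conjI[OF c],
      rule exI[of _ "s * l"], intro allI impI, rule ccontr)
    fix G N and "is" :: "'d list" and \<rho> :: real
    assume der: "\<forall>js i z. length js < l \<longrightarrow> z \<in> ball x0 (2 * r) \<longrightarrow>
        ((\<lambda>t. G js (z + t *\<^sub>R axis i 1)) has_real_derivative G (i # js) z) (at 0)"
      and cont: "continuous_on (ball x0 (2 * r)) (G [])" and len: "length is = l"
      and bd: "\<forall>z\<in>ball x0 (2 * r). c0 * N \<le> \<bar>G is z\<bar> \<and> \<bar>G is z\<bar> \<le> K * N"
      and N: "N0 \<le> N" and \<rho>: "0 < \<rho>" "\<rho> \<le> 1"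
    let ?A = "{x \<in> ball x0 r. near_int (c * \<rho>^(s * l)) (G [] x)}"
    assume "\<not> measure lebesgue ?A < \<rho>"
    then have mA: "\<rho> \<le> measure lebesgue ?A" by simp
    have A: "?A \<in> lmeasurable"
      by (rule lmeasurable_near_int_sublevel, rule continuous_on_subset[OF cont]) (use r in auto)
    define P where "P = C * (1/\<rho>)^s"
    have "1 * 1 \<le> C * (1/\<rho>)^s" using C \<rho> by (intro mult_mono one_le_power) auto
    then have P: "P \<ge> 1" by (simp add: P_def)
    have Npos: "N > 0" using N0 N by linarith
    \<comment> \<open>\<open>\<tau>\<close> is chosen so that the mixed difference stays below \<open>1/2\<close>: being near an integer
      then means being near \<open>0\<close>, against the lower bound on the derivative.\<close>
    define \<tau> where "\<tau> = root l (1 / (2 * N * K * P^l))"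
    have \<tau>pos: "\<tau> > 0" using Npos K P l by (simp add: \<tau>_def real_root_gt_zero)
    have \<tau>l: "\<tau>^l = 1 / (2 * N * K * P^l)"
      unfolding \<tau>_def using Npos K P l by (intro real_root_pow_pos) auto
    have lP\<tau>: "real l * (P * \<tau>) \<le> r"
    proof (rule power_le_imp_le_base)
      have "(real l * (P * \<tau>)) ^ l = real l ^ l / (2 * N * K)"
        using P by (simp add: power_mult_distrib \<tau>l)
      also have "\<dots> \<le> r ^ l"
      proof -
        have "(real l / r)^l / (2 * K) \<le> N" using N by (simp add: N0_def)
        then show ?thesis using r K Npos by (simp add: field_simps power_divide)
      qed
      also have "\<dots> = r ^ Suc (l - 1)" using l by simp
      finally show "(real l * (P * \<tau>)) ^ Suc (l - 1) \<le> r ^ Suc (l - 1)" using l by simp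
    qed (use r in simp)
    have P\<tau>: "P * \<tau> \<le> r"
    proof -
      have "1 * (P * \<tau>) \<le> real l * (P * \<tau>)"
        using l P \<tau>pos by (intro mult_right_mono) auto
      then show ?thesis using lP\<tau> by linarith
    qed
    \<comment> \<open>The directions are prescribed in reverse order because
      \<open>mixed_diff_mvt\<close> reverses them once more.\<close>
    have "\<exists>hs x. map fst hs = rev is \<and> (\<forall>(i, h)\<in>set hs. \<tau> \<le> h \<and> h \<le> C * (1/\<rho>)^s * \<tau>) \<and>
       x \<in> ball x0 r \<and> near_int (2^l * (c * \<rho>^(s * l))) (mixed_diff hs (G []) x)"
      using P\<tau> len by (intro near[OF _ \<rho> \<tau>pos _ A _ mA]) (auto simp: P_def)
    then obtain hs x where hs: "map fst hs = rev is" "\<forall>(i, h)\<in>set hs. \<tau> \<le> h \<and> h \<le> P * \<tau>"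
      and x: "x \<in> ball x0 r" and nr: "near_int (2^l * (c * \<rho>^(s * l))) (mixed_diff hs (G []) x)"
      unfolding P_def by blast
    have lhs: "length hs = l" using hs(1) len by (metis length_map length_rev)
    have sumh: "(\<Sum>(i, h)\<leftarrow>hs. h) \<le> r"
      using sum_list_snd_le[of hs "P * \<tau>"] hs(2) lP\<tau> lhs by fastforce
    have sub: "cball x (\<Sum>(i, h)\<leftarrow>hs. h) \<subseteq> ball x0 (2 * r)"
    proof (intro subsetI)
      fix z assume "z \<in> cball x (\<Sum>(i, h)\<leftarrow>hs. h)"
      then show "z \<in> ball x0 (2 * r)"
        using sumh x dist_triangle[of x0 z x] by simp
    qed
    have "\<exists>\<xi>\<in>cball x (\<Sum>(i, h)\<leftarrow>hs. h). mixed_diff hs (G []) x =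
        (\<Prod>(i, h)\<leftarrow>hs. h) * G (rev (map fst hs) @ []) \<xi>"
    proof (rule mixed_diff_mvt[where k = l, OF _ _ sub])
      show "((\<lambda>t. G js (z + t *\<^sub>R axis i 1)) has_real_derivative G (i # js) z) (at 0)"
        if "length js < l" "z \<in> ball x0 (2 * r)" for js i z
        using der that by blast
      show "0 < h" if "(i, h) \<in> set hs" for i h
        using hs(2) that \<tau>pos by fastforce
    qed (simp add: lhs)
    then obtain \<xi> where "\<xi> \<in> ball x0 (2 * r)"
      and \<xi>: "mixed_diff hs (G []) x = (\<Prod>(i, h)\<leftarrow>hs. h) * G is \<xi>"
      using sub hs(1) by auto
    then have G\<xi>: "c0 * N \<le> \<bar>G is \<xi>\<bar>" "\<bar>G is \<xi>\<bar> \<le> K * N" using bd by auto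
    define H where "H = (\<Prod>(i, h)\<leftarrow>hs. h)"
    have H: "\<tau>^l \<le> H" "H \<le> (P * \<tau>)^l"
      unfolding H_def using prod_list_snd_bounds[OF hs(2)] \<tau>pos lhs by auto
    have Hpos: "H > 0" using H(1) \<tau>pos by (meson less_le_trans zero_less_power)
    have "\<bar>mixed_diff hs (G []) x\<bar> = H * \<bar>G is \<xi>\<bar>"
      using \<xi> Hpos by (simp add: H_def abs_mult)
    moreover have "H * \<bar>G is \<xi>\<bar> \<le> (P * \<tau>)^l * (K * N)"
      using H G\<xi> Hpos by (intro mult_mono) auto
    moreover have "(P * \<tau>)^l * (K * N) = 1/2"
      using Npos K P by (simp add: power_mult_distrib \<tau>l)
    moreover have "\<tau>^l * (c0 * N) \<le> H * \<bar>G is \<xi>\<bar>"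
      using H G\<xi> Hpos c0 Npos by (intro mult_mono) auto
    moreover have "\<tau>^l * (c0 * N) = 2^l * (c * \<rho>^(s * l))"
      using Npos K P C \<rho> by (simp add: \<tau>l c_def P_def power_mult_distrib power_divide power_mult) (simp add: mult_ac)
    ultimately show False
      using near_int_small[OF nr] by linarith
  qed
qed

section \<open>Uniform sublevel estimates from nondegeneracy\<close>

text \<open>Compactness of the unit sphere: the sum of the absolute inner products is continuous
  there and has no zero, since a vector orthogonal to a spanning set is orthogonal to itself. Some
  summand is at least the average.\<close>

lemma span_UNIV_inner_lower_bound:
  fixes S :: "'a::euclidean_space set"
  assumes "finite S" "span S = UNIV"
  shows "\<exists>c>0. \<forall>\<omega>. \<exists>v\<in>S. c * norm \<omega> \<le> \<bar>\<omega> \<bullet> v\<bar>"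
proof -
  have "S \<noteq> {}"
  proof
    assume "S = {}"
    then have "(UNIV :: 'a set) = {0}" using assms by simp
    then show False using nonempty_Basis nonzero_Basis by blast
  qed
  define \<phi> where "\<phi> \<omega> = (\<Sum>v\<in>S. \<bar>\<omega> \<bullet> v\<bar>)" for \<omega>
  have "continuous_on (sphere (0::'a) 1) \<phi>"
    unfolding \<phi>_def by (intro continuous_intros)
  moreover have "sphere (0::'a) 1 \<noteq> {}" by simp
  ultimately obtain u where u: "u \<in> sphere 0 1" and min: "\<And>w. w \<in> sphere 0 1 \<Longrightarrow> \<phi> u \<le> \<phi> w"
    using continuous_attains_inf[of "sphere (0::'a) 1" \<phi>] by auto
  have "\<phi> u > 0"
  proof (rule ccontr)
    assume "\<not> \<phi> u > 0"
    moreover have "\<phi> u \<ge> 0" by (simp add: \<phi>_def sum_nonneg)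
    ultimately have "\<phi> u = 0" by simp
    then have "\<forall>v\<in>S. orthogonal u v"
      using assms(1) by (simp add: \<phi>_def sum_nonneg_eq_0_iff orthogonal_def)
    then have "orthogonal u u" using assms(2) orthogonal_to_span[of u S u] by auto
    then show False using u by (simp add: orthogonal_self)
  qed
  define c where "c = \<phi> u / card S"
  have card: "card S > 0" using assms(1) \<open>S \<noteq> {}\<close> by (simp add: card_gt_0_iff)
  have c: "c > 0" using \<open>\<phi> u > 0\<close> card by (simp add: c_def)
  have "\<exists>v\<in>S. c * norm \<omega> \<le> \<bar>\<omega> \<bullet> v\<bar>" for \<omega>
  proof (cases "\<omega> = 0")
    case False
    show ?thesis
    proof (rule ccontr)
      assume "\<not> ?thesis"
      then have "(\<Sum>v\<in>S. \<bar>\<omega> \<bullet> v\<bar>) < (\<Sum>v\<in>S. c * norm \<omega>)"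
        using assms(1) \<open>S \<noteq> {}\<close> by (intro sum_strict_mono) auto
      also have "\<dots> = norm \<omega> * \<phi> u" using card by (simp add: c_def)
      also have "\<dots> \<le> norm \<omega> * \<phi> (\<omega> /\<^sub>R norm \<omega>)"
        using False by (intro mult_left_mono min) auto
      also have "\<dots> = (\<Sum>v\<in>S. \<bar>\<omega> \<bullet> v\<bar>)"
        using False by (simp add: \<phi>_def sum_distrib_left abs_mult mult.assoc[symmetric])
      finally show False by simp
    qed
  qed (use \<open>S \<noteq> {}\<close> in auto)
  then show ?thesis using c by blast
qed

text \<open>\<open>partial_deriv\<close> is defined through the total operator
  \<open>vector_derivative\<close>; the differentiability clause of \<open>Ck_on\<close> is what
  makes it a genuine derivative.\<close>

lemma iterated_partial_has_derivative:
  fixes g :: "real ^ 'd::finite \<Rightarrow> real ^ 'm"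
  assumes "Ck_on k g V" "length js < k" "z \<in> V"
  shows "((\<lambda>t. y \<bullet> iterated_partial js g (z + t *\<^sub>R axis i 1)) has_real_derivative
      y \<bullet> iterated_partial (i # js) g z) (at 0)"
proof -
  have "(\<lambda>t. iterated_partial js g (z + t *\<^sub>R axis i 1)) differentiable (at (0 :: real))"
    using assms unfolding Ck_on_def by blast
  then have "((\<lambda>t. iterated_partial js g (z + t *\<^sub>R axis i 1)) has_vector_derivative
      iterated_partial (i # js) g z) (at 0)"
    unfolding vector_derivative_works iterated_partial_def partial_deriv_def by simp
  then show ?thesis
    unfolding has_real_derivative_iff_has_vector_derivative
    by (rule bounded_linear.has_vector_derivative[OF bounded_linear_inner_right])
qed

lemma finite_lists_length_between: "finite {is :: 'd::finite list. a \<le> length is \<and> length is \<le> k}"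
  by (rule finite_subset[OF _ finite_lists_length_le[of UNIV k]]) auto

text \<open>For every \<open>y\<close> some derivative of order between 1 and \<open>k\<close> has
  inner product with \<open>y\<close> of size comparable to \<open>norm y\<close> on a whole ball.
  Which derivative dominates depends on \<open>y\<close>, but there are only finitely many
  candidates.\<close>

lemma nondegenerate_sublevel_measure:
  fixes g :: "real ^ 'd::finite \<Rightarrow> real ^ 'm"
  assumes V: "open V" "x0 \<in> V" and Ck: "Ck_on k g V"
    and span: "span {iterated_partial is g x0 | is. 1 \<le> length is \<and> length is \<le> k} = UNIV"
  shows "\<exists>r>0. ball x0 r \<subseteq> V \<and> (\<exists>N0>0. \<exists>c>0. \<exists>s::nat. \<forall>y \<rho>.
    N0 \<le> norm y \<longrightarrow> 0 < \<rho> \<longrightarrow> \<rho> \<le> 1 \<longrightarrow>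
    measure lebesgue {x \<in> ball x0 r. near_int (c * \<rho>^s) (y \<bullet> g x)} < \<rho>)"
proof -
  define L where "L = {is :: 'd list. 1 \<le> length is \<and> length is \<le> k}"
  have finL: "finite L" unfolding L_def by (rule finite_lists_length_between)
  define D where "D is = iterated_partial is g x0" for "is"
  have "{iterated_partial is g x0 | is. 1 \<le> length is \<and> length is \<le> k} = D ` L"
    by (auto simp: D_def L_def)
  then obtain c1 where c1: "c1 > 0" and low: "\<And>\<omega>. \<exists>is\<in>L. c1 * norm \<omega> \<le> \<bar>\<omega> \<bullet> D is\<bar>"
    using span_UNIV_inner_lower_bound[of "D ` L"] finL span by auto
  \<comment> \<open>One radius serves all \<open>y\<close>, because only the finitely many
    derivatives in \<open>L\<close> have to stay within \<open>c1 / 2\<close> of their values at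
    \<open>x0\<close>.\<close>
  have "\<exists>R>0. \<forall>z\<in>ball x0 R. z \<in> V \<and> (\<forall>is\<in>L. dist (iterated_partial is g z) (D is) < c1 / 2)"
  proof -
    have "\<forall>\<^sub>F z in nhds x0. dist (iterated_partial is g z) (D is) < c1 / 2" if "is \<in> L" for "is"
    proof -
      have "continuous_on V (iterated_partial is g)"
        using Ck that by (auto simp: Ck_on_def L_def)
      then have "isCont (iterated_partial is g) x0"
        using V continuous_on_eq_continuous_at by blast
      then have "(iterated_partial is g \<longlongrightarrow> D is) (nhds x0)"
        unfolding D_def isCont_def by (simp add: tendsto_nhds_iff)
      then show ?thesis using c1 by (intro tendstoD) auto
    qed
    then have "\<forall>\<^sub>F z in nhds x0. z \<in> V \<and> (\<forall>is\<in>L. dist (iterated_partial is g z) (D is) < c1 / 2)"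
      using finL V by (intro eventually_conj eventually_nhds_in_open eventually_ball_finite) auto
    then obtain R where "R > 0" "\<forall>z. dist z x0 < R \<longrightarrow> z \<in> V \<and> (\<forall>is\<in>L. dist (iterated_partial is g z) (D is) < c1 / 2)"
      unfolding eventually_nhds_metric by blast
    then show ?thesis by (intro exI[of _ R]) (auto simp: dist_commute)
  qed
  then obtain R where R: "R > 0" "ball x0 R \<subseteq> V"
    and close: "\<And>z is. z \<in> ball x0 R \<Longrightarrow> is \<in> L \<Longrightarrow> dist (iterated_partial is g z) (D is) < c1 / 2"
    by blast
  define r where "r = R / 2"
  have r: "r > 0" "2 * r = R" using R by (auto simp: r_def)
  define K where "K = (\<Sum>is\<in>L. norm (D is)) + c1 / 2"
  have K: "K > 0" using c1 by (simp add: K_def sum_nonneg add_nonneg_pos)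
  have bounds: "\<exists>is\<in>L. \<forall>z\<in>ball x0 R. c1 / 2 * norm y \<le> \<bar>y \<bullet> iterated_partial is g z\<bar> \<and>
      \<bar>y \<bullet> iterated_partial is g z\<bar> \<le> K * norm y" for y
  proof -
    obtain "is" where "is": "is \<in> L" and l: "c1 * norm y \<le> \<bar>y \<bullet> D is\<bar>" using low by blast
    have "c1 / 2 * norm y \<le> \<bar>y \<bullet> iterated_partial is g z\<bar> \<and>
      \<bar>y \<bullet> iterated_partial is g z\<bar> \<le> K * norm y" if "z \<in> ball x0 R" for z
    proof -
      have "norm (iterated_partial is g z - D is) \<le> c1 / 2"
        using close[OF that "is"] by (simp add: dist_norm)
      then have "norm y * norm (iterated_partial is g z - D is) \<le> norm y * (c1 / 2)"
        by (intro mult_left_mono) auto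
      then have 1: "\<bar>y \<bullet> (iterated_partial is g z - D is)\<bar> \<le> norm y * (c1 / 2)"
        using Cauchy_Schwarz_ineq2 order_trans by blast
      have "norm (D is) \<le> (\<Sum>is\<in>L. norm (D is))"
        using finL "is" by (intro member_le_sum) auto
      then have "norm y * norm (D is) \<le> norm y * (\<Sum>is\<in>L. norm (D is))"
        by (intro mult_left_mono) auto
      then have 2: "\<bar>y \<bullet> D is\<bar> \<le> norm y * (\<Sum>is\<in>L. norm (D is))"
        using Cauchy_Schwarz_ineq2 order_trans by blast
      have "y \<bullet> iterated_partial is g z = y \<bullet> D is + y \<bullet> (iterated_partial is g z - D is)"
        by (simp add: inner_diff_right)
      moreover have "K * norm y = norm y * (\<Sum>is\<in>L. norm (D is)) + norm y * (c1 / 2)"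
        by (simp add: K_def algebra_simps)
      moreover have "c1 * norm y = norm y * (c1 / 2) + norm y * (c1 / 2)" "c1 / 2 * norm y = norm y * (c1 / 2)"
        by simp_all
      ultimately show ?thesis using 1 2 l by linarith
    qed
    then show ?thesis using "is" by blast
  qed
  \<comment> \<open>The estimate for those \<open>y\<close> whose dominant derivative has order
    \<open>l\<close>. It survives enlarging \<open>N0\<close> and \<open>s\<close> and shrinking
    \<open>c\<close> (\<open>mono\<close> below), so the constants for the orders up to
    \<open>k\<close> can be merged into one triple.\<close>
  define Good where "Good N0 c s l \<longleftrightarrow> (\<forall>y \<rho> is. is \<in> L \<longrightarrow> length is = l \<longrightarrow>
    (\<forall>z\<in>ball x0 R. c1 / 2 * norm y \<le> \<bar>y \<bullet> iterated_partial is g z\<bar> \<and>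
      \<bar>y \<bullet> iterated_partial is g z\<bar> \<le> K * norm y) \<longrightarrow>
    N0 \<le> norm y \<longrightarrow> 0 < \<rho> \<longrightarrow> \<rho> \<le> 1 \<longrightarrow>
    measure lebesgue {x \<in> ball x0 r. near_int (c * \<rho>^s) (y \<bullet> g x)} < \<rho>)" for N0 c s l
  have contg: "continuous_on V g"
    using Ck unfolding Ck_on_def by (metis foldr.simps(1) id_apply iterated_partial_def le0 list.size(3))
  have each: "\<exists>N0>0. \<exists>c>0. \<exists>s. Good N0 c s l" if l: "1 \<le> l" "l \<le> k" for l
  proof -
    from near_int_sublevel_measure[OF r(1) l(1) _ K, of "c1 / 2" x0] c1
    obtain N0 c s where N0: "N0 > 0" "c > 0" and *: "\<forall>G N is \<rho>.
      (\<forall>js i z. length js < l \<longrightarrow> z \<in> ball x0 (2 * r) \<longrightarrow>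
        ((\<lambda>t. G js (z + t *\<^sub>R axis i 1)) has_real_derivative G (i # js) z) (at 0)) \<longrightarrow>
      continuous_on (ball x0 (2 * r)) (G []) \<longrightarrow> length is = l \<longrightarrow>
      (\<forall>z\<in>ball x0 (2 * r). c1 / 2 * N \<le> \<bar>G is z\<bar> \<and> \<bar>G is z\<bar> \<le> K * N) \<longrightarrow>
      N0 \<le> N \<longrightarrow> 0 < \<rho> \<longrightarrow> \<rho> \<le> 1 \<longrightarrow>
      measure lebesgue {x \<in> ball x0 r. near_int (c * \<rho>^s) (G [] x)} < \<rho>"
      by auto
    have "Good N0 c s l"
      unfolding Good_def
    proof (intro allI impI)
      fix y and \<rho> :: real and "is"
      assume "length is = l" "N0 \<le> norm y" "0 < \<rho>" "\<rho> \<le> 1"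
        and "\<forall>z\<in>ball x0 R. c1 / 2 * norm y \<le> \<bar>y \<bullet> iterated_partial is g z\<bar> \<and>
          \<bar>y \<bullet> iterated_partial is g z\<bar> \<le> K * norm y"
      moreover have "continuous_on (ball x0 R) (\<lambda>z. y \<bullet> iterated_partial [] g z)"
        using contg R(2) by (auto simp: iterated_partial_def intro!: continuous_intros intro: continuous_on_subset)
      moreover have "((\<lambda>t. y \<bullet> iterated_partial js g (z + t *\<^sub>R axis i 1)) has_real_derivative
          y \<bullet> iterated_partial (i # js) g z) (at 0)" if "length js < l" "z \<in> ball x0 R" for js i z
        using that l R(2) by (intro iterated_partial_has_derivative[OF Ck]) auto
      ultimately have "measure lebesgue {x \<in> ball x0 r. near_int (c * \<rho>^s) (y \<bullet> iterated_partial [] g x)} < \<rho>"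
        using *[rule_format, of "\<lambda>js z. y \<bullet> iterated_partial js g z" "is" "norm y" \<rho>] r(2) by auto
      then show "measure lebesgue {x \<in> ball x0 r. near_int (c * \<rho>^s) (y \<bullet> g x)} < \<rho>"
        by (simp add: iterated_partial_def)
    qed
    then show ?thesis using N0 by blast
  qed
  have meas: "{x \<in> ball x0 r. near_int \<delta> (y \<bullet> g x)} \<in> lmeasurable" for \<delta> y
  proof (rule lmeasurable_near_int_sublevel)
    have "ball x0 r \<subseteq> V" using R r by auto
    then show "continuous_on (ball x0 r) (\<lambda>x. y \<bullet> g x)"
      by (intro continuous_intros continuous_on_subset[OF contg])
  qed
  have mono: "Good N0' c' s' l"
    if "Good N0 c s l" "N0 \<le> N0'" "c' \<le> c" "s \<le> s'" "c > 0" "c' > 0" for N0 N0' c c' s s' l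
    unfolding Good_def
  proof (intro allI impI)
    fix y and \<rho> :: real and "is"
    assume *: "is \<in> L" "length is = l" "\<forall>z\<in>ball x0 R. c1 / 2 * norm y \<le> \<bar>y \<bullet> iterated_partial is g z\<bar> \<and>
        \<bar>y \<bullet> iterated_partial is g z\<bar> \<le> K * norm y" "N0' \<le> norm y" and \<rho>: "0 < \<rho>" "\<rho> \<le> 1"
    have "c' * \<rho>^s' \<le> c * \<rho>^s"
      using that \<rho> by (intro mult_mono power_decreasing) auto
    then have "{x \<in> ball x0 r. near_int (c' * \<rho>^s') (y \<bullet> g x)} \<subseteq> {x \<in> ball x0 r. near_int (c * \<rho>^s) (y \<bullet> g x)}"
      using near_int_mono by blast
    then have "measure lebesgue {x \<in> ball x0 r. near_int (c' * \<rho>^s') (y \<bullet> g x)}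
        \<le> measure lebesgue {x \<in> ball x0 r. near_int (c * \<rho>^s) (y \<bullet> g x)}"
      using meas by (intro measure_mono_fmeasurable) (auto simp: fmeasurableD)
    also have "\<dots> < \<rho>"
    proof -
      have "N0 \<le> norm y" using that(2) *(4) by linarith
      then show ?thesis
        using that(1)[unfolded Good_def, rule_format, OF *(1,2) *(3)[rule_format] _ \<rho>] by blast
    qed
    finally show "measure lebesgue {x \<in> ball x0 r. near_int (c' * \<rho>^s') (y \<bullet> g x)} < \<rho>" .
  qed
  have "\<exists>N0>0. \<exists>c>0. \<exists>s. \<forall>l\<in>{1..n}. Good N0 c s l" if "n \<le> k" for n
    using that
  proof (induction n)
    case 0
    have "(1::real) > 0" "\<forall>l\<in>{1..0}. Good 1 1 0 l" by auto
    then show ?case by blast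
  next
    case (Suc n)
    obtain N0 c s where 1: "N0 > 0" "c > 0" "\<forall>l\<in>{1..n}. Good N0 c s l" using Suc by auto
    obtain N1 d t where 2: "N1 > 0" "d > 0" "Good N1 d t (Suc n)" using each[of "Suc n"] Suc by auto
    have "Good (max N0 N1) (min c d) (max s t) l" if "l \<in> {1..Suc n}" for l
    proof (cases "l = Suc n")
      case True
      then have "Good N1 d t l" using 2 by simp
      then show ?thesis by (rule mono) (use 1 2 in simp_all)
    next
      case False
      then have "Good N0 c s l" using 1 that by simp
      then show ?thesis by (rule mono) (use 1 2 in simp_all)
    qed
    then have "\<forall>l\<in>{1..Suc n}. Good (max N0 N1) (min c d) (max s t) l" by blast
    moreover have "max N0 N1 > 0" "min c d > 0" using 1 2 by auto
    ultimately show ?case by blast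
  qed
  then obtain N0 c s where N0: "N0 > 0" "c > 0" and good: "\<forall>l\<in>{1..k}. Good N0 c s l" by blast
  have "measure lebesgue {x \<in> ball x0 r. near_int (c * \<rho>^s) (y \<bullet> g x)} < \<rho>"
    if "N0 \<le> norm y" "0 < \<rho>" "\<rho> \<le> 1" for y \<rho>
  proof -
    obtain "is" where "is": "is \<in> L" and "\<forall>z\<in>ball x0 R. c1 / 2 * norm y \<le> \<bar>y \<bullet> iterated_partial is g z\<bar> \<and>
      \<bar>y \<bullet> iterated_partial is g z\<bar> \<le> K * norm y" using bounds by blast
    moreover have "Good N0 c s (length is)" using good "is" by (auto simp: L_def)
    ultimately show ?thesis using that unfolding Good_def by blast
  qed
  moreover have "ball x0 r \<subseteq> V" using R r by auto
  ultimately show ?thesis using N0 r(1) by blast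
qed

section \<open>Transference to the transposed matrix\<close>

lemma of_int_vec_nth [simp]: "of_int_vec v $ i = of_int (v $ i)"
  by (simp add: of_int_vec_def)

lemma inner_of_int_vec: "of_int_vec u \<bullet> of_int_vec v = of_int (\<Sum>i\<in>UNIV. u $ i * v $ i)"
  by (simp add: inner_vec_def)

lemma card_int_vec_box: "card {y :: int ^ 'm. \<forall>j. 0 \<le> y $ j \<and> y $ j \<le> int T} = (T + 1) ^ CARD('m)"
proof -
  have "{y :: int ^ 'm. \<forall>j. 0 \<le> y $ j \<and> y $ j \<le> int T} =
      vec_lambda ` (PiE UNIV (\<lambda>_. {0..int T}))"
  proof (intro subset_antisym subsetI)
    fix y :: "int ^ 'm" assume "y \<in> {y. \<forall>j. 0 \<le> y $ j \<and> y $ j \<le> int T}"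
    then have "vec_nth y \<in> PiE UNIV (\<lambda>_. {0..int T})" by auto
    then show "y \<in> vec_lambda ` (PiE UNIV (\<lambda>_. {0..int T}))"
      by (metis image_eqI vec_nth_inverse)
  qed auto
  moreover have "inj_on vec_lambda (PiE (UNIV :: 'm set) (\<lambda>_. {0..int T}))"
    by (auto simp: inj_on_def)
  ultimately have "card {y :: int ^ 'm. \<forall>j. 0 \<le> y $ j \<and> y $ j \<le> int T} =
      card (PiE (UNIV :: 'm set) (\<lambda>_. {0..int T}))"
    by (simp add: card_image)
  moreover have "nat (int T + 1) = T + 1" by linarith
  ultimately show ?thesis by (simp add: card_PiE)
qed

lemma floor_eq_imp_dist_less_1:
  fixes s t :: real
  assumes "\<lfloor>s\<rfloor> = \<lfloor>t\<rfloor>"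
  shows "\<bar>s - t\<bar> < 1"
  using assms by linarith

text \<open>Besides the usual boxes for \<open>\<alpha>\<^sup>T y\<close>, the pigeonhole also records the residue that
  forces the difference \<open>(y, x)\<close> to be orthogonal to the given solution \<open>(p, q)\<close>. The coordinate
  of \<open>\<alpha>\<^sup>T y + x\<close> at the largest entry of \<open>q\<close> is then determined by the others and needs
  no boxes of its own; this is the gain over Dirichlet's theorem.\<close>

lemma transference_pigeonhole:
  fixes \<alpha> :: "real ^ 'n ^ 'm" and q :: "int ^ 'n" and p :: "int ^ 'm" and T H :: nat
  assumes \<eta>: "norm (\<alpha> *v of_int_vec q + of_int_vec p) \<le> \<eta>"
    and q: "q \<noteq> 0" "norm (of_int_vec q) \<le> Q" and H: "H \<ge> 1"
    and count: "2 * real CARD('m) * T * \<eta> * real H ^ CARD('n) + 2 * Q * real H ^ (CARD('n) - 1)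
        < (real T + 1) ^ CARD('m)"
  shows "\<exists>(y :: int ^ 'm) (x :: int ^ 'n). y \<noteq> 0 \<and> (\<forall>j. \<bar>y $ j\<bar> \<le> int T) \<and>
    (\<forall>i. \<bar>(transpose \<alpha> *v of_int_vec y + of_int_vec x) $ i\<bar> \<le> real CARD('n) / real H)"
proof -
  define w where "w = \<alpha> *v of_int_vec q + of_int_vec p"
  have w: "\<bar>w $ j\<bar> \<le> \<eta>" for j using component_le_norm_cart[of w j] \<eta> by (simp add: w_def)
  have \<eta>0: "\<eta> \<ge> 0" using \<eta> norm_ge_zero order_trans by blast
  \<comment> \<open>The largest entry of \<open>q\<close>, because the other coordinates of
    \<open>\<xi>\<close> are multiplied by \<open>q $ i / q $ i0\<close> when the coordinate at
    \<open>i0\<close> is recovered.\<close>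
  obtain i0 where i0: "\<And>i. \<bar>q $ i\<bar> \<le> \<bar>q $ i0\<bar>"
  proof -
    have "Max (range (\<lambda>i. \<bar>q $ i\<bar>)) \<in> range (\<lambda>i. \<bar>q $ i\<bar>)" by (intro Max_in) auto
    then obtain i0 where "Max (range (\<lambda>i. \<bar>q $ i\<bar>)) = \<bar>q $ i0\<bar>" by (rule imageE)
    moreover have "\<bar>q $ i\<bar> \<le> Max (range (\<lambda>i. \<bar>q $ i\<bar>))" for i by (intro Max_ge) auto
    ultimately have "\<bar>q $ i\<bar> \<le> \<bar>q $ i0\<bar>" for i by simp
    then show ?thesis by (rule that)
  qed
  have q0: "q $ i0 \<noteq> 0"
  proof
    assume "q $ i0 = 0"
    then have "q $ i = 0" for i using i0[of i] by simp
    then show False using q(1) by (simp add: vec_eq_iff)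
  qed
  define z where "z = real_of_int \<bar>q $ i0\<bar>"
  have z: "z > 0" using q0 by (simp add: z_def)
  have zQ: "z \<le> Q"
    using component_le_norm_cart[of "of_int_vec q" i0] q(2) by (simp add: z_def)
  \<comment> \<open>The width of the boxes for \<open>of_int_vec y \<bullet> w\<close>: dividing by
    \<open>q $ i0\<close> turns it into \<open>1 / H\<close>, the precision of the other
    coordinates.\<close>
  define \<tau> where "\<tau> = z / H"
  have \<tau>: "\<tau> > 0" using z H by (simp add: \<tau>_def)
  define Y where "Y = {y :: int ^ 'm. \<forall>j. 0 \<le> y $ j \<and> y $ j \<le> int T}"
  define U where "U y i = (transpose \<alpha> *v of_int_vec y) $ i" for y i
  define X where "X y i = - \<lfloor>U y i\<rfloor>" for y i
  \<comment> \<open>The product \<open>x $ i0 * q $ i0\<close> must cancel this quantity for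
    \<open>x\<close> to satisfy \<open>x \<bullet> q = y \<bullet> p\<close>. Since
    \<open>x $ i0\<close> has to be an integer, only the residue modulo \<open>q $ i0\<close> is
    recorded.\<close>
  define R where "R y = (\<Sum>i\<in>UNIV - {i0}. X y i * q $ i) - (\<Sum>j\<in>UNIV. y $ j * p $ j)" for y
  define f where "f y = (restrict (\<lambda>i. \<lfloor>real H * frac (U y i)\<rfloor>) (UNIV - {i0}),
      \<lfloor>(of_int_vec y \<bullet> w) / \<tau>\<rfloor>, R y mod \<bar>q $ i0\<bar>)" for y
  define b where "b = real CARD('m) * T * \<eta> / \<tau>"
  have b0: "b \<ge> 0" using \<eta>0 \<tau> by (simp add: b_def)
  define Z where "Z = PiE (UNIV - {i0}) (\<lambda>_. {0..int H - 1}) \<times> {\<lfloor>-b\<rfloor>..\<lfloor>b\<rfloor>} \<times> {0..<\<bar>q $ i0\<bar>}"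
  have finZ: "finite Z" unfolding Z_def by (intro finite_cartesian_product finite_PiE) auto
  have fZ: "f ` Y \<subseteq> Z"
  proof
    fix v assume "v \<in> f ` Y"
    then obtain y where y: "y \<in> Y" "v = f y" by blast
    have 1: "\<lfloor>real H * frac (U y i)\<rfloor> \<in> {0..int H - 1}" for i
    proof -
      have "0 \<le> frac (U y i)" "frac (U y i) < 1" using frac_lt_1 by auto
      then have "0 \<le> real H * frac (U y i)" "real H * frac (U y i) < real H * 1"
        using H by (auto intro!: mult_strict_left_mono)
      then show ?thesis by (simp add: le_floor_iff floor_less_iff zle_diff1_eq del: zle_diff1_eq) linarith
    qed
    have "\<bar>of_int_vec y \<bullet> w\<bar> \<le> (\<Sum>j\<in>(UNIV :: 'm set). \<bar>real_of_int (y $ j) * w $ j\<bar>)"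
      unfolding inner_vec_def by (simp add: sum_abs)
    also have "\<dots> \<le> (\<Sum>j\<in>(UNIV :: 'm set). real T * \<eta>)"
    proof (intro sum_mono)
      fix j
      have "0 \<le> y $ j" "y $ j \<le> int T" using y(1) by (auto simp: Y_def)
      then have "\<bar>real_of_int (y $ j)\<bar> \<le> real T" by linarith
      then show "\<bar>real_of_int (y $ j) * w $ j\<bar> \<le> real T * \<eta>"
        unfolding abs_mult using w[of j] by (intro mult_mono) auto
    qed
    also have "\<dots> = b * \<tau>" using \<tau> by (simp add: b_def)
    finally have "\<bar>of_int_vec y \<bullet> w\<bar> \<le> b * \<tau>" .
    then have "- b \<le> (of_int_vec y \<bullet> w) / \<tau>" "(of_int_vec y \<bullet> w) / \<tau> \<le> b"
      using \<tau> by (simp_all add: pos_divide_le_eq pos_le_divide_eq)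
    then have 2: "\<lfloor>(of_int_vec y \<bullet> w) / \<tau>\<rfloor> \<in> {\<lfloor>-b\<rfloor>..\<lfloor>b\<rfloor>}"
      unfolding atLeastAtMost_iff by (intro conjI floor_mono) auto
    show "v \<in> Z" using 1 2 q0 unfolding y(2) f_def Z_def by auto
  qed
  \<comment> \<open>The \<open>z\<close> residues are paid for by the coarser boxes:
    \<open>b\<close> carries a factor \<open>1 / z\<close>, so \<open>b * z\<close> does not depend
    on \<open>z\<close>.\<close>
  have "real (card Z) = real H ^ (CARD('n) - 1) * real_of_int (\<lfloor>b\<rfloor> - \<lfloor>-b\<rfloor> + 1) * z"
  proof -
    have "\<lfloor>-b\<rfloor> \<le> \<lfloor>b\<rfloor>" using b0 by (intro floor_mono) simp
    then show ?thesis
      unfolding Z_def z_def by (simp add: card_cartesian_product card_PiE)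
  qed
  also have "\<dots> \<le> real H ^ (CARD('n) - 1) * (2 * b + 2) * z"
  proof (intro mult_right_mono mult_left_mono)
    show "real_of_int (\<lfloor>b\<rfloor> - \<lfloor>-b\<rfloor> + 1) \<le> 2 * b + 2" by linarith
  qed (use z in auto)
  also have "\<dots> = 2 * real CARD('m) * T * \<eta> * real H ^ CARD('n) + 2 * z * real H ^ (CARD('n) - 1)"
  proof -
    have "b * z = real CARD('m) * T * \<eta> * real H" using z H by (simp add: b_def \<tau>_def)
    moreover have "real H ^ CARD('n) = real H * real H ^ (CARD('n) - 1)"
      by (metis Suc_pred' power_Suc zero_less_card_finite)
    ultimately show ?thesis by (simp add: algebra_simps)
  qed
  also have "\<dots> \<le> 2 * real CARD('m) * T * \<eta> * real H ^ CARD('n) + 2 * Q * real H ^ (CARD('n) - 1)"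
    using zQ by (intro add_left_mono mult_right_mono) auto
  also have "\<dots> < (real T + 1) ^ CARD('m)" by (rule count)
  also have "\<dots> = real (card Y)" unfolding Y_def card_int_vec_box by (simp add: add.commute)
  finally have "card Z < card Y" by simp
  then have "card (f ` Y) < card Y" using card_mono[OF finZ fZ] by linarith
  then have "\<not> inj_on f Y" by (rule pigeonhole)
  then obtain y1 y2 where y12: "y1 \<in> Y" "y2 \<in> Y" "y1 \<noteq> y2" "f y1 = f y2"
    by (auto simp: inj_on_def)
  define y where "y = y1 - y2"
  have y0: "y \<noteq> 0" using y12 by (simp add: y_def)
  have yT: "\<bar>y $ j\<bar> \<le> int T" for j
  proof -
    have "0 \<le> y1 $ j" "y1 $ j \<le> int T" "0 \<le> y2 $ j" "y2 $ j \<le> int T"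
      using y12 by (auto simp: Y_def)
    then show ?thesis by (simp add: y_def)
  qed
  have ov: "(of_int_vec y :: real ^ 'm) = of_int_vec y1 - of_int_vec y2"
    by (simp add: y_def vec_eq_iff)
  have "R y1 mod \<bar>q $ i0\<bar> = R y2 mod \<bar>q $ i0\<bar>" using y12 by (simp add: f_def)
  then have "q $ i0 dvd R y1 - R y2" by (metis abs_dvd_iff mod_eq_dvd_iff)
  then obtain X0 where X0: "R y1 - R y2 = q $ i0 * X0" by blast
  \<comment> \<open>Away from \<open>i0\<close> the entries are differences of rounded values; the
    entry at \<open>i0\<close> is the quotient from the congruence and gives
    \<open>x \<bullet> q = y \<bullet> p\<close>.\<close>
  define x :: "int ^ 'n" where "x = (\<chi> i. if i = i0 then - X0 else X y1 i - X y2 i)"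
  have "(\<Sum>i\<in>UNIV. x $ i * q $ i) = x $ i0 * q $ i0 + (\<Sum>i\<in>UNIV - {i0}. x $ i * q $ i)"
    by (rule sum.remove) auto
  also have "(\<Sum>i\<in>UNIV - {i0}. x $ i * q $ i) = (\<Sum>i\<in>UNIV - {i0}. X y1 i * q $ i) - (\<Sum>i\<in>UNIV - {i0}. X y2 i * q $ i)"
    unfolding sum_subtractf[symmetric] by (intro sum.cong) (auto simp: x_def algebra_simps)
  also have "x $ i0 * q $ i0 = - (R y1 - R y2)" using X0 by (simp add: x_def)
  finally have xq: "(\<Sum>i\<in>UNIV. x $ i * q $ i) = (\<Sum>j\<in>UNIV. y $ j * p $ j)"
    by (simp add: R_def y_def left_diff_distrib sum_subtractf)
  define \<xi> where "\<xi> = transpose \<alpha> *v of_int_vec y + of_int_vec x"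
  have "\<xi> \<bullet> of_int_vec q = (transpose \<alpha> *v of_int_vec y) \<bullet> of_int_vec q + of_int (\<Sum>i\<in>UNIV. x $ i * q $ i)"
    by (simp add: \<xi>_def inner_add_left inner_of_int_vec)
  also have "\<dots> = of_int_vec y \<bullet> w"
    unfolding xq by (simp add: w_def inner_add_right inner_of_int_vec transpose_matrix_vector dot_lmul_matrix)
  finally have \<xi>q: "\<xi> \<bullet> of_int_vec q = of_int_vec y \<bullet> w" .
  have "\<lfloor>(of_int_vec y1 \<bullet> w) / \<tau>\<rfloor> = \<lfloor>(of_int_vec y2 \<bullet> w) / \<tau>\<rfloor>" using y12 by (simp add: f_def)
  from floor_eq_imp_dist_less_1[OF this] have "\<bar>(of_int_vec y \<bullet> w) / \<tau>\<bar> < 1"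
    by (simp add: ov inner_diff_left diff_divide_distrib)
  then have yw: "\<bar>of_int_vec y \<bullet> w\<bar> \<le> \<tau>" using \<tau> by (simp add: pos_divide_less_eq)
  have \<xi>i: "\<bar>\<xi> $ i\<bar> \<le> 1 / H" if "i \<noteq> i0" for i
  proof -
    have "fst (f y1) i = fst (f y2) i" using y12 by simp
    then have "\<lfloor>real H * frac (U y1 i)\<rfloor> = \<lfloor>real H * frac (U y2 i)\<rfloor>"
      using that by (simp add: f_def)
    from floor_eq_imp_dist_less_1[OF this]
    have "\<bar>real H * (frac (U y1 i) - frac (U y2 i))\<bar> < 1" by (simp add: right_diff_distrib)
    moreover have "frac (U y1 i) - frac (U y2 i) = \<xi> $ i"
      using that by (simp add: \<xi>_def x_def X_def U_def frac_def ov matrix_vector_mult_diff_distrib)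
    ultimately have "real H * \<bar>\<xi> $ i\<bar> < 1" by (simp add: abs_mult)
    then show ?thesis using H by (simp add: field_simps)
  qed
  have qz: "\<bar>real_of_int (q $ i)\<bar> \<le> z" for i using i0[of i] by (simp add: z_def)
  have "\<bar>\<xi> $ i0\<bar> \<le> real CARD('n) / H"
  proof -
    have "\<xi> \<bullet> of_int_vec q = (\<Sum>i\<in>UNIV. \<xi> $ i * of_int (q $ i))"
      by (simp add: inner_vec_def)
    also have "\<dots> = \<xi> $ i0 * of_int (q $ i0) + (\<Sum>i\<in>UNIV - {i0}. \<xi> $ i * of_int (q $ i))"
      by (rule sum.remove) auto
    finally have "\<xi> $ i0 * of_int (q $ i0) = of_int_vec y \<bullet> w - (\<Sum>i\<in>UNIV - {i0}. \<xi> $ i * of_int (q $ i))"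
      using \<xi>q by simp
    moreover have "\<bar>\<Sum>i\<in>UNIV - {i0}. \<xi> $ i * of_int (q $ i)\<bar> \<le> (\<Sum>i\<in>UNIV - {i0}. 1 / H * z)"
    proof (rule order_trans[OF sum_abs], intro sum_mono)
      fix i assume "i \<in> UNIV - {i0}"
      then show "\<bar>\<xi> $ i * of_int (q $ i)\<bar> \<le> 1 / H * z"
        unfolding abs_mult using \<xi>i[of i] qz[of i] by (intro mult_mono) auto
    qed
    moreover have "(\<Sum>i\<in>UNIV - {i0}. 1 / H * z) = (real CARD('n) - 1) * (z / H)"
      by (simp add: of_nat_diff Suc_leI)
    moreover have "\<bar>\<xi> $ i0 * of_int (q $ i0)\<bar> = \<bar>\<xi> $ i0\<bar> * z" by (simp add: abs_mult z_def)
    \<comment> \<open>The coordinate at \<open>i0\<close> is solved from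
      \<open>\<xi> \<bullet> q = y \<bullet> w\<close>: one error \<open>\<tau> = z / H\<close> from
      the right side and one error \<open>z / H\<close> from each remaining coordinate.\<close>
    ultimately have "\<bar>\<xi> $ i0\<bar> * z \<le> z / H + (real CARD('n) - 1) * (z / H)"
      using yw unfolding \<tau>_def by linarith
    then have "\<bar>\<xi> $ i0\<bar> * z \<le> (real CARD('n) / H) * z" by (simp add: left_diff_distrib diff_divide_distrib)
    then show ?thesis using z by (rule mult_right_le_imp_le)
  qed
  moreover have "1 / real H \<le> real CARD('n) / H"
    using H by (intro divide_right_mono) (auto simp: Suc_leI)
  ultimately have "\<bar>\<xi> $ i\<bar> \<le> real CARD('n) / H" for i
    using \<xi>i[of i] by (cases "i = i0") auto
  then show ?thesis using y0 yT unfolding \<xi>_def by blast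
qed

lemma eventually_powr_ge:
  fixes c B :: real
  assumes "c > 0"
  shows "\<forall>\<^sub>F A in at_top. B \<le> A powr c"
proof -
  have "B \<le> A powr c" if "A \<ge> (max 1 B) powr (1 / c)" for A
  proof -
    have "max 1 B = ((max 1 B) powr (1 / c)) powr c"
      using assms by (simp add: powr_powr)
    also have "\<dots> \<le> A powr c"
      using that assms by (intro powr_mono2) auto
    finally show ?thesis by simp
  qed
  then show ?thesis unfolding eventually_at_top_linorder by blast
qed

text \<open>The pigeonhole is applied to a solution at height
  \<open>Q = A powr (a - \<epsilon>1)\<close>, with \<open>T\<close> about \<open>A / m\<close> and
  \<open>H\<close> about \<open>A powr (a + \<epsilon>2)\<close>. Both terms of its count are then
  of order \<open>A powr (m - \<kappa>)\<close>, which is below \<open>(T + 1) ^ CARD('m)\<close>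
  for large \<open>A\<close>.\<close>

lemma very_singular_transpose:
  fixes \<alpha> :: "real ^ 'n ^ 'm"
  assumes "very_singular \<alpha>"
  shows "\<exists>e>0. \<forall>\<^sub>F A in at_top. \<exists>(y :: int ^ 'm) (x :: int ^ 'n). y \<noteq> 0 \<and> norm (of_int_vec y) \<le> A \<and>
    norm (transpose \<alpha> *v of_int_vec y + of_int_vec x) \<le> A powr - (real CARD('m) / real CARD('n) + e)"
proof -
  define m n where "m = real CARD('m)" and "n = real CARD('n)"
  have mn: "m \<ge> 1" "n \<ge> 1" by (auto simp: m_def n_def Suc_leI)
  define a where "a = m / n"
  have a: "a > 0" "1 / a = n / m" "a * n = m" using mn by (auto simp: a_def)
  obtain \<epsilon> Q\<epsilon> where \<epsilon>: "\<epsilon> > 0" and sing: "\<And>Q. Q \<ge> Q\<epsilon> \<Longrightarrow> \<exists>(p :: int ^ 'm) (q :: int ^ 'n).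
      norm (\<alpha> *v of_int_vec q + of_int_vec p) \<le> Q powr - (1 / a + \<epsilon>) \<and>
      0 < norm (of_int_vec q :: real ^ 'n) \<and> norm (of_int_vec q :: real ^ 'n) \<le> Q"
    using assms unfolding very_singular_def a(2) m_def n_def by blast
  \<comment> \<open>Solved from
    \<open>\<epsilon>1 * (1 / a + \<epsilon>) = a * \<epsilon> / 2\<close>: lowering the exponent of
    \<open>Q\<close> by \<open>\<epsilon>1\<close> uses up half of the gain
    \<open>a * \<epsilon>\<close>.\<close>
  define \<epsilon>1 where "\<epsilon>1 = a * \<epsilon> / (2 * (1 / a + \<epsilon>))"
  have "1 / a > 0" using a(1) by simp
  then have pos: "1 / a + \<epsilon> > 0" using \<epsilon> by linarith
  have \<epsilon>1: "\<epsilon>1 > 0" using a \<epsilon> pos by (simp add: \<epsilon>1_def)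
  have \<epsilon>1': "\<epsilon>1 * (1 / a + \<epsilon>) = a * \<epsilon> / 2"
  proof -
    have "a * \<epsilon> / (2 * d) * d = a * \<epsilon> / 2" if "d > 0" for d :: real using that by simp
    from this[OF pos] show ?thesis by (simp only: \<epsilon>1_def)
  qed
  have \<epsilon>1a: "a - \<epsilon>1 > 0"
  proof -
    have "a * \<epsilon> < a * (2 * (1 / a + \<epsilon>))" 
    proof -
      have "a * (2 * (1 / a + \<epsilon>)) = 2 + 2 * (a * \<epsilon>)" using a(1) by (simp add: distrib_left)
      moreover have "a * \<epsilon> > 0" using a(1) \<epsilon> by simp
      ultimately show ?thesis by linarith
    qed
    then show ?thesis using pos by (simp add: \<epsilon>1_def pos_divide_less_eq)
  qed
  \<comment> \<open>The two terms of the count have exponents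
    \<open>m - a * \<epsilon> / 2 + \<kappa>\<close> and
    \<open>m - \<epsilon>1 + \<kappa> - \<epsilon>2\<close>; the two bounds on
    \<open>\<kappa>\<close> bring both below \<open>m - \<kappa>\<close>.\<close>
  define \<kappa> where "\<kappa> = min (a * \<epsilon> / 4) (\<epsilon>1 / 2)"
  have \<kappa>: "\<kappa> > 0" "\<kappa> \<le> a * \<epsilon> / 4" "\<kappa> \<le> \<epsilon>1 / 2" using a \<epsilon> \<epsilon>1 by (auto simp: \<kappa>_def)
  define \<epsilon>2 where "\<epsilon>2 = \<kappa> / n"
  have \<epsilon>2: "\<epsilon>2 > 0" "\<epsilon>2 * n = \<kappa>" using \<kappa> mn by (auto simp: \<epsilon>2_def)
  \<comment> \<open>Collects the constants of both terms and the loss \<open>m ^ CARD('m)\<close>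
    from \<open>real T + 1 \<ge> A / m\<close>; the factor \<open>A powr \<kappa>\<close> absorbs
    it. Likewise half of \<open>\<epsilon>2\<close> is spent below on the factor
    \<open>n * n\<close>.\<close>
  define C where "C = (2 * m + 1) * 2 ^ CARD('n) * m ^ CARD('m) + 1"
  have "\<forall>\<^sub>F A in at_top. A \<ge> (1::real) \<and> Q\<epsilon> \<le> A powr (a - \<epsilon>1) \<and> C \<le> A powr \<kappa> \<and> n * n \<le> A powr (\<epsilon>2 / 2)"
    using \<epsilon>1a \<kappa> \<epsilon>2 by (intro eventually_conj eventually_powr_ge eventually_ge_at_top) auto
  then have "\<forall>\<^sub>F A in at_top. \<exists>(y :: int ^ 'm) (x :: int ^ 'n). y \<noteq> 0 \<and> norm (of_int_vec y) \<le> A \<and>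
    norm (transpose \<alpha> *v of_int_vec y + of_int_vec x) \<le> A powr - (a + \<epsilon>2 / 2)"
  proof eventually_elim
    fix A :: real
    assume A: "1 \<le> A \<and> Q\<epsilon> \<le> A powr (a - \<epsilon>1) \<and> C \<le> A powr \<kappa> \<and> n * n \<le> A powr (\<epsilon>2 / 2)"
    define Q where "Q = A powr (a - \<epsilon>1)"
    define \<eta> where "\<eta> = Q powr - (1 / a + \<epsilon>)"
    define T where "T = nat \<lfloor>A / m\<rfloor>"
    define B where "B = A powr (a + \<epsilon>2)"
    define H where "H = nat \<lceil>B\<rceil>"
    have B: "B \<ge> 1" using A a \<epsilon>2 by (simp add: B_def ge_one_powr_ge_zero)
    have H: "real H \<ge> B" "real H \<le> 2 * B" "H \<ge> 1" using B unfolding H_def by linarith+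
    have Am: "A / m \<ge> 0" using A mn by simp
    have T: "real T + 1 \<ge> A / m" "real T \<le> A / m" using Am unfolding T_def by linarith+
    have "A / m \<le> A" using A mn by (simp add: divide_le_eq mult_le_cancel_left1)
    then have TA: "real T \<le> A" using T by linarith
    obtain p :: "int ^ 'm" and q :: "int ^ 'n" where pq: "norm (\<alpha> *v of_int_vec q + of_int_vec p) \<le> \<eta>"
      "0 < norm (of_int_vec q :: real ^ 'n)" "norm (of_int_vec q :: real ^ 'n) \<le> Q"
      using sing[of Q] A unfolding \<eta>_def Q_def by blast
    have q0: "q \<noteq> 0" using pq(2) by (auto simp: of_int_vec_def zero_vec_def)
    have A0: "A > 0" using A by linarith
    have Hn: "real H ^ k \<le> 2 ^ k * A powr ((a + \<epsilon>2) * k)" for k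
    proof -
      have "real H ^ k \<le> (2 * B) ^ k" using H by (intro power_mono) auto
      also have "\<dots> = 2 ^ k * A powr ((a + \<epsilon>2) * k)"
        using A0 by (simp add: power_mult_distrib B_def powr_power mult.commute)
      finally show ?thesis .
    qed
    have "2 * m * T * \<eta> * real H ^ CARD('n) \<le> 2 * m * A * \<eta> * (2 ^ CARD('n) * A powr ((a + \<epsilon>2) * n))"
      using TA mn Hn[of "CARD('n)"] A0 unfolding n_def[symmetric]
      by (intro mult_mono) (auto simp: \<eta>_def)
    also have "\<dots> = 2 * m * 2 ^ CARD('n) * A powr (1 + (a - \<epsilon>1) * - (1 / a + \<epsilon>) + (a + \<epsilon>2) * n)"
      using A0 by (simp add: \<eta>_def Q_def powr_powr powr_add)
    also have "1 + (a - \<epsilon>1) * - (1 / a + \<epsilon>) + (a + \<epsilon>2) * n = m - a * \<epsilon> / 2 + \<kappa>"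
    proof -
      have "(a - \<epsilon>1) * - (d + \<epsilon>) = - (a * d) - a * \<epsilon> + \<epsilon>1 * (d + \<epsilon>)" for d
        by (simp add: algebra_simps)
      from this[of "1 / a"]
      have "(a - \<epsilon>1) * - (1 / a + \<epsilon>) = - 1 - a * \<epsilon> + \<epsilon>1 * (1 / a + \<epsilon>)"
        using a(1) by simp
      moreover have "(a + \<epsilon>2) * n = m + \<kappa>" using a(3) \<epsilon>2(2) by (simp add: distrib_right)
      ultimately show ?thesis using \<epsilon>1' by linarith
    qed
    also have "2 * m * 2 ^ CARD('n) * A powr (m - a * \<epsilon> / 2 + \<kappa>) \<le> 2 * m * 2 ^ CARD('n) * A powr (m - \<kappa>)"
      using A \<kappa> mn by (intro mult_left_mono powr_mono) auto
    finally have 1: "2 * m * T * \<eta> * real H ^ CARD('n) \<le> 2 * m * 2 ^ CARD('n) * A powr (m - \<kappa>)" .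
    have n1: "real (CARD('n) - 1) = n - 1" using mn by (simp add: n_def of_nat_diff)
    have "2 * Q * real H ^ (CARD('n) - 1) \<le> 2 * Q * (2 ^ (CARD('n) - 1) * A powr ((a + \<epsilon>2) * (n - 1)))"
      using Hn[of "CARD('n) - 1"] unfolding n1 by (intro mult_left_mono) (auto simp: Q_def)
    also have "\<dots> = 2 ^ CARD('n) * A powr (a - \<epsilon>1 + (a + \<epsilon>2) * (n - 1))"
    proof -
      have "(2::real) ^ CARD('n) = 2 * 2 ^ (CARD('n) - 1)"
        by (metis Suc_pred' power_Suc zero_less_card_finite)
      then show ?thesis by (simp add: Q_def powr_add)
    qed
    also have "\<dots> \<le> 2 ^ CARD('n) * A powr (m - \<kappa>)"
    proof (intro mult_left_mono powr_mono)
      have "a - \<epsilon>1 + (a + \<epsilon>2) * (n - 1) = m - \<epsilon>1 + \<kappa> - \<epsilon>2"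
        using a(3) \<epsilon>2(2) by (simp add: algebra_simps)
      then show "a - \<epsilon>1 + (a + \<epsilon>2) * (n - 1) \<le> m - \<kappa>" using \<kappa> \<epsilon>2 by linarith
    qed (use A in auto)
    finally have 2: "2 * Q * real H ^ (CARD('n) - 1) \<le> 2 ^ CARD('n) * A powr (m - \<kappa>)" .
    have "(2 * m * 2 ^ CARD('n) * A powr (m - \<kappa>) + 2 ^ CARD('n) * A powr (m - \<kappa>)) * m ^ CARD('m) = (C - 1) * A powr (m - \<kappa>)"
      by (simp add: C_def algebra_simps)
    also have "\<dots> < C * A powr (m - \<kappa>)" using A0 by (simp add: left_diff_distrib)
    also have "\<dots> \<le> A powr \<kappa> * A powr (m - \<kappa>)" using A by (intro mult_right_mono) auto
    also have "\<dots> = A powr m" using A0 by (simp flip: powr_add)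
    also have "\<dots> = A ^ CARD('m)" using A0 by (simp add: m_def powr_realpow)
    also have "\<dots> = (A / m) ^ CARD('m) * m ^ CARD('m)" using mn by (simp flip: power_mult_distrib)
    also have "\<dots> \<le> (real T + 1) ^ CARD('m) * m ^ CARD('m)"
      using T Am mn by (intro mult_right_mono power_mono) auto
    finally have "2 * m * 2 ^ CARD('n) * A powr (m - \<kappa>) + 2 ^ CARD('n) * A powr (m - \<kappa>) < (real T + 1) ^ CARD('m)"
      using mn by (simp add: mult_less_cancel_right)
    then have "2 * m * T * \<eta> * real H ^ CARD('n) + 2 * Q * real H ^ (CARD('n) - 1) < (real T + 1) ^ CARD('m)"
      using 1 2 by linarith
    from transference_pigeonhole[OF pq(1) q0 pq(3) H(3) this[unfolded m_def]]
    obtain y :: "int ^ 'm" and x :: "int ^ 'n" where y: "y \<noteq> 0" "\<And>j. \<bar>y $ j\<bar> \<le> int T"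
      and x: "\<And>i. \<bar>(transpose \<alpha> *v of_int_vec y + of_int_vec x) $ i\<bar> \<le> n / real H"
      unfolding n_def by blast
    have "norm (of_int_vec y :: real ^ 'm) \<le> (\<Sum>j\<in>(UNIV :: 'm set). \<bar>(of_int_vec y :: real ^ 'm) $ j\<bar>)"
      by (rule norm_le_l1_cart)
    also have "\<dots> \<le> (\<Sum>j\<in>(UNIV :: 'm set). real T)"
    proof (intro sum_mono)
      fix j show "\<bar>(of_int_vec y :: real ^ 'm) $ j\<bar> \<le> real T"
        using y(2)[of j] by simp
    qed
    also have "\<dots> \<le> A" using T(2) mn by (simp add: m_def field_simps)
    finally have ny: "norm (of_int_vec y :: real ^ 'm) \<le> A" .
    have "norm (transpose \<alpha> *v of_int_vec y + of_int_vec x) \<le>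
        (\<Sum>i\<in>UNIV. \<bar>(transpose \<alpha> *v of_int_vec y + of_int_vec x) $ i\<bar>)"
      by (rule norm_le_l1_cart)
    also have "\<dots> \<le> (\<Sum>i\<in>(UNIV :: 'n set). n / real H)" by (intro sum_mono x)
    also have "\<dots> = n * n / real H" by (simp add: n_def)
    also have "\<dots> \<le> n * n / B" using H B by (intro divide_left_mono) auto
    also have "\<dots> \<le> A powr (\<epsilon>2 / 2) / B" using A B by (intro divide_right_mono) auto
    also have "\<dots> = A powr - (a + \<epsilon>2 / 2)"
    proof -
      have "- (a + \<epsilon>2 / 2) = \<epsilon>2 / 2 - (a + \<epsilon>2)" by simp
      then show ?thesis by (simp only: B_def powr_diff)
    qed
    finally show "\<exists>(y :: int ^ 'm) (x :: int ^ 'n). y \<noteq> 0 \<and> norm (of_int_vec y) \<le> A \<and>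
        norm (transpose \<alpha> *v of_int_vec y + of_int_vec x) \<le> A powr - (a + \<epsilon>2 / 2)"
      using y(1) ny by blast
  qed
  moreover have "\<epsilon>2 / 2 > 0" using \<epsilon>2 by simp
  ultimately show ?thesis unfolding a_def m_def n_def by blast
qed

section \<open>A criterion for bad approximability\<close>

lemma of_int_vec_eq_0_iff [simp]: "of_int_vec v = 0 \<longleftrightarrow> v = 0"
  by (simp add: vec_eq_iff)

lemma finite_int_vec_norm_le: "finite {v :: int ^ 'k. norm (of_int_vec v) \<le> r}"
proof -
  have "{v :: int ^ 'k. norm (of_int_vec v) \<le> r} \<subseteq> vec_lambda ` (PiE UNIV (\<lambda>_. {-\<lceil>r\<rceil>..\<lceil>r\<rceil>}))"
  proof
    fix v :: "int ^ 'k" assume v: "v \<in> {v. norm (of_int_vec v) \<le> r}"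
    have "v $ i \<in> {-\<lceil>r\<rceil>..\<lceil>r\<rceil>}" for i
    proof -
      have "\<bar>real_of_int (v $ i)\<bar> \<le> r"
        using component_le_norm_cart[of "of_int_vec v" i] v by simp
      then show ?thesis unfolding atLeastAtMost_iff by linarith
    qed
    then have "vec_nth v \<in> PiE UNIV (\<lambda>_. {-\<lceil>r\<rceil>..\<lceil>r\<rceil>})" by (simp add: PiE_iff)
    then show "v \<in> vec_lambda ` (PiE UNIV (\<lambda>_. {-\<lceil>r\<rceil>..\<lceil>r\<rceil>}))"
      by (metis image_eqI vec_nth_inverse)
  qed
  then show ?thesis
    by (rule finite_subset) (intro finite_imageI finite_PiE, auto)
qed

lemma norm_of_int_vec_ge_1:
  assumes "v \<noteq> 0"
  shows "norm (of_int_vec v) \<ge> 1"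
proof -
  obtain i where "v $ i \<noteq> 0" using assms by (auto simp: vec_eq_iff)
  then have "\<bar>real_of_int (v $ i)\<bar> \<ge> 1" by linarith
  then show ?thesis using component_le_norm_cart[of "of_int_vec v" i] by simp
qed

section \<open>Best approximations and the growth of their radii\<close>

text \<open>The integer vector \<open>x\<close> ranges over an infinite set, but only pairs at least
  as good as one fixed pair compete, and for these \<open>x\<close> is bounded in terms of
  \<open>y\<close>.\<close>

lemma best_approximation_exists:
  fixes B :: "real ^ 'm ^ 'n"
  assumes "\<exists>(y :: int ^ 'm) (x :: int ^ 'n). y \<noteq> 0 \<and> norm (of_int_vec y) \<le> A"
  shows "\<exists>(y :: int ^ 'm) (x :: int ^ 'n). y \<noteq> 0 \<and> norm (of_int_vec y) \<le> A \<and>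
    (\<forall>y' x'. y' \<noteq> 0 \<longrightarrow> norm (of_int_vec y') \<le> A \<longrightarrow>
      norm (B *v of_int_vec y + of_int_vec x) \<le> norm (B *v of_int_vec y' + of_int_vec x'))"
proof -
  obtain y0 :: "int ^ 'm" where y0: "y0 \<noteq> 0" "norm (of_int_vec y0) \<le> A" using assms by blast
  define \<mu> where "\<mu> = (\<lambda>(y, x). norm (B *v of_int_vec y + of_int_vec x))"
  define t where "t = \<mu> (y0, 0)"
  define S where "S = {(y :: int ^ 'm, x :: int ^ 'n). y \<noteq> 0 \<and> norm (of_int_vec y) \<le> A \<and> \<mu> (y, x) \<le> t}"
  have "S \<subseteq> (SIGMA y:{y. norm (of_int_vec y) \<le> A}. {x. norm (of_int_vec x) \<le> t + norm (B *v of_int_vec y)})"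
  proof (clarsimp simp: S_def \<mu>_def)
    fix y :: "int ^ 'm" and x :: "int ^ 'n"
    assume "norm (B *v of_int_vec y + of_int_vec x) \<le> t"
    moreover have "norm (of_int_vec x) \<le> norm (B *v of_int_vec y + of_int_vec x) + norm (B *v of_int_vec y)"
      using norm_triangle_ineq4[of "B *v of_int_vec y + of_int_vec x" "B *v of_int_vec y"] by simp
    ultimately show "norm (of_int_vec x) \<le> t + norm (B *v of_int_vec y)" by linarith
  qed
  then have fin: "finite S"
    by (rule finite_subset) (intro finite_SigmaI finite_int_vec_norm_le)
  have ne: "(y0, 0) \<in> S" using y0 by (simp add: S_def t_def)
  have "Min (\<mu> ` S) \<in> \<mu> ` S" using fin ne by (intro Min_in) auto
  then obtain z where z: "z \<in> S" "Min (\<mu> ` S) = \<mu> z" by (rule imageE)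
  obtain y x where yx: "z = (y, x)" by (cases z)
  have min: "\<mu> (y, x) \<le> \<mu> v" if "v \<in> S" for v
    using fin that z(2) yx by (metis Min_le finite_imageI imageI)
  have "\<mu> (y, x) \<le> \<mu> (y', x')" if "y' \<noteq> 0" "norm (of_int_vec y') \<le> A" for y' x'
  proof (cases "\<mu> (y', x') \<le> t")
    case True
    then show ?thesis using that by (intro min) (simp add: S_def)
  next
    case False
    then show ?thesis using min[OF ne] by (simp add: t_def)
  qed
  then show ?thesis using z(1) unfolding yx S_def \<mu>_def by auto
qed

text \<open>\<open>y j\<close> minimizes \<open>\<parallel>B y + x\<parallel>\<close> over \<open>0 < \<parallel>y\<parallel> \<le> R j\<close>, and \<open>R (Suc j)\<close> is the largest
  radius for which \<open>y j\<close> is still a better approximation than the exponent \<open>b\<close> requires.\<close>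

lemma best_approximation_sequence:
  fixes B :: "real ^ 'm ^ 'n"
  assumes a: "a > 0" and e: "e > 0"
    and ev: "\<forall>\<^sub>F A in at_top. \<exists>(y :: int ^ 'm) (x :: int ^ 'n). y \<noteq> 0 \<and> norm (of_int_vec y) \<le> A \<and>
      norm (B *v of_int_vec y + of_int_vec x) \<le> A powr - (a + e)"
    and nz: "\<And>(y :: int ^ 'm) (x :: int ^ 'n). y \<noteq> 0 \<Longrightarrow> B *v of_int_vec y + of_int_vec x \<noteq> 0"
  shows "\<exists>b>a. \<exists>\<nu>>1. \<exists>(R :: nat \<Rightarrow> real) (y :: nat \<Rightarrow> int ^ 'm) (x :: nat \<Rightarrow> int ^ 'n). R 0 \<ge> 2 \<and>
    (\<forall>j. R j powr \<nu> \<le> R (Suc j) \<and> norm (of_int_vec (y j)) \<le> R j \<and> R j < norm (of_int_vec (y (Suc j))) \<and>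
      norm (B *v of_int_vec (y j) + of_int_vec (x j)) \<le> R (Suc j) powr - b)"
proof -
  define \<mu> where "\<mu> y x = norm (B *v of_int_vec y + of_int_vec x)" for y :: "int ^ 'm" and x :: "int ^ 'n"
  obtain A1 where A1: "\<And>A. A \<ge> A1 \<Longrightarrow> \<exists>(y :: int ^ 'm) (x :: int ^ 'n). y \<noteq> 0 \<and> norm (of_int_vec y) \<le> A \<and>
      \<mu> y x \<le> A powr - (a + e)"
    using ev unfolding \<mu>_def eventually_at_top_linorder by blast
  define A0 where "A0 = max A1 2"
  have "\<exists>(y :: int ^ 'm) (x :: int ^ 'n). y \<noteq> 0 \<and> norm (of_int_vec y) \<le> A \<and>
      \<mu> y x \<le> A powr - (a + e) \<and>
      (\<forall>y' x'. y' \<noteq> 0 \<longrightarrow> norm (of_int_vec y') \<le> A \<longrightarrow> \<mu> y x \<le> \<mu> y' x')" if "A \<ge> A0" for A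
  proof -
    have "A1 \<le> A" using that by (simp add: A0_def)
    from A1[OF this] obtain y1 :: "int ^ 'm" and x1 :: "int ^ 'n" where 1: "y1 \<noteq> 0" "norm (of_int_vec y1) \<le> A"
      "\<mu> y1 x1 \<le> A powr - (a + e)"
      by (elim exE conjE)
    obtain y :: "int ^ 'm" and x :: "int ^ 'n" where 2: "y \<noteq> 0" "norm (of_int_vec y) \<le> A"
      "\<forall>y' x'. y' \<noteq> 0 \<longrightarrow> norm (of_int_vec y') \<le> A \<longrightarrow> \<mu> y x \<le> \<mu> y' x'"
      using best_approximation_exists[of A B] 1(1,2) unfolding \<mu>_def by blast
    then have "\<mu> y x \<le> A powr - (a + e)" using 1 order_trans by blast
    then show ?thesis using 2 by blast
  qed
  then obtain Y :: "real \<Rightarrow> int ^ 'm" and X :: "real \<Rightarrow> int ^ 'n" where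
    Y: "\<And>A. A \<ge> A0 \<Longrightarrow> Y A \<noteq> 0" "\<And>A. A \<ge> A0 \<Longrightarrow> norm (of_int_vec (Y A)) \<le> A"
    and \<mu>: "\<And>A. A \<ge> A0 \<Longrightarrow> \<mu> (Y A) (X A) \<le> A powr - (a + e)"
    and min: "\<And>A y' x'. A \<ge> A0 \<Longrightarrow> y' \<noteq> 0 \<Longrightarrow> norm (of_int_vec y') \<le> A \<Longrightarrow> \<mu> (Y A) (X A) \<le> \<mu> y' x'"
    by metis
  \<comment> \<open>Strictly between the two exponents: the gap below \<open>a + e\<close> makes the
    radii grow (\<open>\<nu> > 1\<close>), the gap above \<open>a\<close> is kept for the
    approximability criterion.\<close>
  define b where "b = a + e / 2"
  have b: "b > a" "b > 0" "b < a + e" using a e by (auto simp: b_def)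
  define \<nu> where "\<nu> = (a + e) / b"
  have \<nu>: "\<nu> > 1" using b by (simp add: \<nu>_def)
  \<comment> \<open>The next radius \<open>R (Suc j)\<close> solves
    \<open>\<mu> = R (Suc j) powr - b\<close>, where \<open>\<mu>\<close> is the minimum at radius
    \<open>R j\<close>.\<close>
  define R where "R = rec_nat A0 (\<lambda>_ r. \<mu> (Y r) (X r) powr - (1 / b))"
  have R0: "R 0 = A0" and RS: "R (Suc j) = \<mu> (Y (R j)) (X (R j)) powr - (1 / b)" for j
    by (simp_all add: R_def)
  have step: "r powr \<nu> \<le> \<mu> (Y r) (X r) powr - (1 / b)" if "r \<ge> A0" for r
  proof -
    \<comment> \<open>This is where \<open>nz\<close> enters: a vanishing minimum would make the
      next radius 0, since \<open>0 powr _ = 0\<close>.\<close>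
    have pos: "\<mu> (Y r) (X r) > 0" using nz[OF Y(1)[OF that]] by (simp add: \<mu>_def)
    have "r powr \<nu> = (r powr - (a + e)) powr - (1 / b)"
    proof -
      have "\<nu> = - (a + e) * - (1 / b)" unfolding minus_mult_minus by (simp add: \<nu>_def)
      then show ?thesis by (simp only: powr_powr)
    qed
    also have "\<dots> \<le> \<mu> (Y r) (X r) powr - (1 / b)"
      using pos \<mu>[OF that] b by (intro powr_mono2') auto
    finally show ?thesis .
  qed
  have RA: "R j \<ge> A0" for j
  proof (induction j)
    case (Suc j)
    have "1 \<le> R j" using Suc by (simp add: A0_def)
    then have "R j powr 1 \<le> R j powr \<nu>" using \<nu> by (intro powr_mono) auto
    then show ?case using step[OF Suc] Suc \<open>1 \<le> R j\<close> by (simp add: RS)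
  qed (simp add: R0)
  have R2: "R j \<ge> 2" for j using RA[of j] by (simp add: A0_def)
  have \<mu>R: "\<mu> (Y (R j)) (X (R j)) = R (Suc j) powr - b" for j
  proof -
    have "\<mu> (Y (R j)) (X (R j)) > 0" using nz[OF Y(1)[OF RA]] by (simp add: \<mu>_def)
    then show ?thesis using b by (simp add: RS powr_powr)
  qed
  \<comment> \<open>Otherwise the next vector would already compete at radius \<open>R j\<close>,
    and the minimum there would be at most \<open>R (Suc j) powr - (a + e)\<close>, less than its
    actual value \<open>R (Suc j) powr - b\<close>.\<close>
  have "R j < norm (of_int_vec (Y (R (Suc j))))" for j
  proof (rule ccontr)
    assume "\<not> ?thesis"
    then have "\<mu> (Y (R j)) (X (R j)) \<le> \<mu> (Y (R (Suc j))) (X (R (Suc j)))"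
      using Y(1)[OF RA] by (intro min[OF RA]) auto
    also have "\<dots> \<le> R (Suc j) powr - (a + e)" by (rule \<mu>[OF RA])
    also have "\<dots> < R (Suc j) powr - b"
      using R2[of "Suc j"] b by (intro powr_less_mono) auto
    finally show False by (simp add: \<mu>R)
  qed
  moreover have "R j powr \<nu> \<le> R (Suc j)" for j unfolding RS by (rule step[OF RA])
  ultimately have "R 0 \<ge> 2 \<and> (\<forall>j. R j powr \<nu> \<le> R (Suc j) \<and> norm (of_int_vec (Y (R j))) \<le> R j \<and>
      R j < norm (of_int_vec (Y (R (Suc j)))) \<and>
      norm (B *v of_int_vec (Y (R j)) + of_int_vec (X (R j))) \<le> R (Suc j) powr - b)"
    using R2 Y(2)[OF RA] \<mu>R unfolding \<mu>_def by auto
  then have "\<exists>(y :: nat \<Rightarrow> int ^ 'm) (x :: nat \<Rightarrow> int ^ 'n). R 0 \<ge> 2 \<and>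
      (\<forall>j. R j powr \<nu> \<le> R (Suc j) \<and> norm (of_int_vec (y j)) \<le> R j \<and> R j < norm (of_int_vec (y (Suc j))) \<and>
        norm (B *v of_int_vec (y j) + of_int_vec (x j)) \<le> R (Suc j) powr - b)"
    by (intro exI[of _ "\<lambda>j. Y (R j)"] exI[of _ "\<lambda>j. X (R j)"])
  then show ?thesis using b(1) \<nu> by blast
qed

text \<open>By induction \<open>R j\<close> is at least \<open>R 0 powr (\<nu> ^ j)\<close>. After
  taking logarithms and dividing by \<open>\<nu> ^ j\<close>, the left side tends to 0 and the right
  side is at least a positive constant.\<close>

lemma double_exponential_growth:
  fixes R :: "nat \<Rightarrow> real"
  assumes "R 0 \<ge> 2" "\<nu> > 1" "\<And>j. R j powr \<nu> \<le> R (Suc j)" and \<kappa>: "\<kappa> > 0" and CB: "C > 0" "B > 0"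
  shows "\<forall>\<^sub>F j in sequentially. C * B ^ j \<le> R j powr \<kappa>"
proof -
  have R: "R 0 powr (\<nu> ^ j) \<le> R j" for j
  proof (induction j)
    case (Suc j)
    have "R 0 powr (\<nu> ^ Suc j) = (R 0 powr (\<nu> ^ j)) powr \<nu>" by (simp add: powr_powr mult.commute)
    also have "\<dots> \<le> R j powr \<nu>" using Suc assms(2) by (intro powr_mono2) auto
    also have "\<dots> \<le> R (Suc j)" by (rule assms(3))
    finally show ?case .
  qed (use assms in simp)
  have "(\<lambda>j. ln C * (1 / \<nu>) ^ j + ln B * (of_nat j / \<nu> ^ j)) \<longlonglongrightarrow> ln C * 0 + ln B * 0"
    using assms(2) by (intro tendsto_intros LIMSEQ_realpow_zero lim_n_over_pown) auto
  moreover have "\<kappa> * ln (R 0) > 0" using \<kappa> assms(1) by simp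
  ultimately have "\<forall>\<^sub>F j in sequentially. ln C * (1 / \<nu>) ^ j + ln B * (of_nat j / \<nu> ^ j) < \<kappa> * ln (R 0)"
    by (auto dest: order_tendstoD(2))
  then show ?thesis
  proof eventually_elim
    fix j
    assume "ln C * (1 / \<nu>) ^ j + ln B * (of_nat j / \<nu> ^ j) < \<kappa> * ln (R 0)"
    then have "(ln C * (1 / \<nu>) ^ j + ln B * (of_nat j / \<nu> ^ j)) * \<nu> ^ j \<le> \<kappa> * ln (R 0) * \<nu> ^ j"
      using assms(2) by (intro mult_right_mono) auto
    moreover have "(ln C * (1 / \<nu>) ^ j + ln B * (of_nat j / \<nu> ^ j)) * \<nu> ^ j = ln C + ln B * of_nat j"
      using assms(2) by (simp add: field_simps)
    moreover have "ln (C * B ^ j) = ln C + ln B * of_nat j"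
      using CB by (simp add: ln_mult ln_realpow)
    moreover have "ln (R 0 powr (\<nu> ^ j * \<kappa>)) = \<kappa> * ln (R 0) * \<nu> ^ j"
      using assms(1) by (simp add: ln_powr)
    ultimately have "ln (C * B ^ j) \<le> ln (R 0 powr (\<nu> ^ j * \<kappa>))" by linarith
    then have "C * B ^ j \<le> R 0 powr (\<nu> ^ j * \<kappa>)"
      using CB assms(1) by (subst (asm) ln_le_cancel_iff) auto
    also have "\<dots> = (R 0 powr (\<nu> ^ j)) powr \<kappa>" by (simp add: powr_powr)
    also have "\<dots> \<le> R j powr \<kappa>" using R[of j] \<kappa> by (intro powr_mono2) auto
    finally show "C * B ^ j \<le> R j powr \<kappa>" .
  qed
qed

section \<open>From distances to the integers to bad approximability\<close>

lemma not_near_int_lower_bound: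
  fixes \<alpha> :: "real ^ 'n ^ 'm"
  assumes "\<not> near_int \<delta> (of_int_vec y \<bullet> \<beta>)"
  shows "\<delta> \<le> norm (of_int_vec y :: real ^ 'm) * norm (\<alpha> *v of_int_vec q + \<beta> + of_int_vec p) +
    norm (transpose \<alpha> *v of_int_vec y + of_int_vec x) * norm (of_int_vec q :: real ^ 'n)"
proof -
  define k :: int where "k = (\<Sum>i\<in>UNIV. x $ i * q $ i) - (\<Sum>j\<in>UNIV. y $ j * p $ j)"
  let ?w = "\<alpha> *v of_int_vec q + \<beta> + of_int_vec p" and ?\<xi> = "transpose \<alpha> *v of_int_vec y + of_int_vec x"
  have "of_int_vec y \<bullet> \<beta> - of_int k = of_int_vec y \<bullet> ?w - ?\<xi> \<bullet> of_int_vec q"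
    unfolding k_def
    by (simp add: inner_add_left inner_add_right inner_of_int_vec transpose_matrix_vector dot_lmul_matrix)
  moreover have "\<bar>of_int_vec y \<bullet> \<beta> - of_int k\<bar> \<ge> \<delta>" using assms by (auto simp: near_int_def not_less)
  moreover have "\<bar>of_int_vec y \<bullet> ?w\<bar> \<le> norm (of_int_vec y :: real ^ 'm) * norm ?w"
    "\<bar>?\<xi> \<bullet> of_int_vec q\<bar> \<le> norm ?\<xi> * norm (of_int_vec q :: real ^ 'n)"
    by (rule Cauchy_Schwarz_ineq2)+
  ultimately show ?thesis by linarith
qed

text \<open>Halving the constant makes the inequality strict, so the set of solutions is not merely
  finite but empty.\<close>

lemma badly_approximableI:
  fixes \<alpha> :: "real ^ 'n ^ 'm"
  assumes c: "c > 0"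
    and low: "\<And>(p :: int ^ 'm) (q :: int ^ 'n). q \<noteq> 0 \<Longrightarrow> c * norm (of_int_vec q :: real ^ 'n) powr
      - (real CARD('n) / real CARD('m)) \<le> norm (\<alpha> *v of_int_vec q + \<beta> + of_int_vec p)"
  shows "\<beta> \<in> badly_approximable \<alpha>"
proof -
  have "norm (\<alpha> *v of_int_vec q + \<beta> + of_int_vec p) > c / 2 * norm (of_int_vec q :: real ^ 'n) powr
      - (real CARD('n) / real CARD('m))" if "q \<noteq> 0" for p and q :: "int ^ 'n"
  proof -
    have "norm (of_int_vec q :: real ^ 'n) > 0" using that by simp
    then have "c * norm (of_int_vec q :: real ^ 'n) powr - (real CARD('n) / real CARD('m)) > 0"
      using c by simp
    then show ?thesis using low[OF that, of p] by simp
  qed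
  then have "{(p :: int ^ 'm, q :: int ^ 'n). q \<noteq> 0 \<and>
      norm (\<alpha> *v of_int_vec q + \<beta> + of_int_vec p) \<le> c / 2 * norm (of_int_vec q :: real ^ 'n) powr
        - (real CARD('n) / real CARD('m))} = {}"
    by (auto simp: not_le)
  then have "\<beta> \<notin> approximable (\<lambda>q. c / 2 * q powr - (real CARD('n) / real CARD('m))) \<alpha>"
    unfolding approximable_def mem_Collect_eq by (simp only: finite.emptyI not_not)
  then show ?thesis unfolding badly_approximable_def using c by (auto intro!: exI[of _ "c / 2"])
qed

text \<open>The error term vanishes for every \<open>q\<close>, so one \<open>y\<close> gives a
  positive lower bound independent of \<open>q\<close>, while the required power of
  \<open>norm q\<close> is at most 1.\<close>

lemma badly_approximable_if_exact_relation:
  fixes \<alpha> :: "real ^ 'n ^ 'm"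
  assumes "y \<noteq> 0" "transpose \<alpha> *v of_int_vec y + of_int_vec x = 0" "\<delta> > 0"
    and "\<not> near_int \<delta> (of_int_vec y \<bullet> \<beta>)"
  shows "\<beta> \<in> badly_approximable \<alpha>"
proof (rule badly_approximableI)
  have y: "norm (of_int_vec y :: real ^ 'm) > 0" using assms by simp
  then show "\<delta> / norm (of_int_vec y :: real ^ 'm) > 0" using assms by simp
  fix p :: "int ^ 'm" and q :: "int ^ 'n" assume "q \<noteq> 0"
  then have "norm (of_int_vec q :: real ^ 'n) powr - (real CARD('n) / real CARD('m)) \<le> 1"
    using norm_of_int_vec_ge_1[of q] by (simp add: powr_minus inverse_le_1_iff ge_one_powr_ge_zero)
  then have "\<delta> / norm (of_int_vec y :: real ^ 'm) * norm (of_int_vec q :: real ^ 'n) powr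
      - (real CARD('n) / real CARD('m)) \<le> \<delta> / norm (of_int_vec y :: real ^ 'm) * 1"
    using assms by (intro mult_left_mono) auto
  also have "\<dots> \<le> norm (\<alpha> *v of_int_vec q + \<beta> + of_int_vec p)"
    using not_near_int_lower_bound[OF assms(4), of \<alpha> q p x] assms(2) y by (simp add: pos_divide_le_eq mult.commute)
  finally show "\<delta> / norm (of_int_vec y :: real ^ 'm) * norm (of_int_vec q :: real ^ 'n) powr
      - (real CARD('n) / real CARD('m)) \<le> norm (\<alpha> *v of_int_vec q + \<beta> + of_int_vec p)" .
qed

lemma badly_approximable_if_eventually_not_near_int:
  fixes \<alpha> :: "real ^ 'n ^ 'm" and y :: "nat \<Rightarrow> int ^ 'm" and x :: "nat \<Rightarrow> int ^ 'n"
  assumes b: "real CARD('m) / real CARD('n) < b"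
    and R: "R 0 \<ge> 2" "\<nu> > 1" "\<And>j. R j powr \<nu> \<le> R (Suc j)"
    and y: "\<And>j. norm (of_int_vec (y j)) \<le> R j"
    and x: "\<And>j. norm (transpose \<alpha> *v of_int_vec (y j) + of_int_vec (x j)) \<le> R (Suc j) powr - b"
    and c: "c > 0" "0 < \<theta>" "\<theta> \<le> 1"
    and far: "\<forall>\<^sub>F j in sequentially. \<not> near_int (c * \<theta> ^ j) (of_int_vec (y j) \<bullet> \<beta>)"
  shows "\<beta> \<in> badly_approximable \<alpha>"
proof -
  define a where "a = real CARD('m) / real CARD('n)"
  have a: "a > 0" "real CARD('n) / real CARD('m) = 1 / a" "b > a" using b by (auto simp: a_def)
  define \<delta> where "\<delta> j = c * \<theta> ^ j" for j
  have \<delta>: "\<delta> j > 0" "\<delta> (Suc j) \<le> \<delta> j" for j using c by (auto simp: \<delta>_def mult_le_cancel_left1)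
  have R2: "R j \<ge> 2" for j
  proof (induction j)
    case (Suc j)
    then have "R j powr 1 \<le> R j powr \<nu>" using R(2) by (intro powr_mono) auto
    then show ?case using Suc R(3)[of j] by simp
  qed (use R in simp)
  \<comment> \<open>Chosen so that
    \<open>(R j powr \<kappa>) powr (1 + 1 / a) = R j powr (b / a - 1)\<close>, the power of
    \<open>R j\<close> left over at the end. It is positive because \<open>b > a\<close>, and its
    growth beats the decay of \<open>\<delta> j\<close>.\<close>
  define \<kappa> where "\<kappa> = (b / a - 1) / (1 + 1 / a)"
  have pos: "1 + 1 / a > 0" using a(1) by (simp add: add_pos_pos)
  have "b / a - 1 > 0" using a by (simp add: field_simps)
  then have \<kappa>: "\<kappa> > 0" "\<kappa> * (1 + 1 / a) = b / a - 1" using pos by (auto simp: \<kappa>_def)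
  have "\<forall>\<^sub>F j in sequentially. 2 / c * (1 / \<theta>) ^ j \<le> R j powr \<kappa>"
    using c \<kappa> by (intro double_exponential_growth[OF R]) auto
  with far have "\<forall>\<^sub>F j in sequentially. \<not> near_int (\<delta> j) (of_int_vec (y j) \<bullet> \<beta>) \<and> 2 / \<delta> j \<le> R j powr \<kappa>"
    by eventually_elim (simp add: \<delta>_def power_divide)
  then obtain j1 where j1: "\<And>j. j \<ge> j1 \<Longrightarrow> \<not> near_int (\<delta> j) (of_int_vec (y j) \<bullet> \<beta>)"
    "\<And>j. j \<ge> j1 \<Longrightarrow> 2 / \<delta> j \<le> R j powr \<kappa>"
    unfolding eventually_sequentially by blast
  \<comment> \<open>The second entry covers the \<open>q\<close> for which the search below stops at
    \<open>j1\<close>; for all other \<open>q\<close> the bound holds with constant 1.\<close>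
  define d where "d = min 1 (\<delta> j1 / (2 * R j1))"
  have d: "d > 0" using \<delta>[of j1] R2[of j1] by (simp add: d_def)
  show ?thesis
  proof (rule badly_approximableI[OF d])
    fix p :: "int ^ 'm" and q :: "int ^ 'n" assume q: "q \<noteq> 0"
    define t where "t = norm (of_int_vec q :: real ^ 'n)"
    define w where "w = norm (\<alpha> *v of_int_vec q + \<beta> + of_int_vec p)"
    have t: "t \<ge> 1" unfolding t_def by (rule norm_of_int_vec_ge_1[OF q])
    \<comment> \<open>The error term uses up at most half of \<open>\<delta> j\<close>. Taking the
      least such \<open>j\<close> keeps \<open>R j\<close> small, and failure at the preceding index
      bounds \<open>t\<close> from below.\<close>
    define P where "P j \<longleftrightarrow> j \<ge> j1 \<and> R (Suc j) powr - b * t \<le> \<delta> j / 2" for j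
    have "\<exists>j. P j"
    proof -
      have "\<forall>\<^sub>F j in sequentially. 2 * t / c * (1 / \<theta>) ^ j \<le> R j powr b"
        using c a t by (intro double_exponential_growth[OF R]) auto
      then obtain N where N: "\<And>j. j \<ge> N \<Longrightarrow> 2 * t / c * (1 / \<theta>) ^ j \<le> R j powr b"
        unfolding eventually_sequentially by blast
      define j where "j = max N j1"
      have "2 * t / \<delta> (Suc j) \<le> R (Suc j) powr b"
        using N[of "Suc j"] by (simp add: j_def \<delta>_def power_divide)
      then have "t \<le> R (Suc j) powr b * (\<delta> (Suc j) / 2)" using \<delta>(1)[of "Suc j"] by (simp add: field_simps)
      also have "\<dots> \<le> R (Suc j) powr b * (\<delta> j / 2)"
        using \<delta>(2)[of j] by (intro mult_left_mono) auto
      finally have "R (Suc j) powr - b * t \<le> R (Suc j) powr - b * (R (Suc j) powr b * (\<delta> j / 2))"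
        by (intro mult_left_mono) auto
      also have "\<dots> = \<delta> j / 2"
      proof -
        have "R (Suc j) powr - b * R (Suc j) powr b = 1"
          using R2[of "Suc j"] by (simp flip: powr_add)
        then show ?thesis by (simp flip: mult.assoc)
      qed
      finally show ?thesis unfolding P_def j_def by (intro exI[of _ "max N j1"]) auto
    qed
    define j where "j = (LEAST j. P j)"
    have Pj: "P j" unfolding j_def using \<open>\<exists>j. P j\<close> by (metis LeastI)
    have "\<delta> j \<le> norm (of_int_vec (y j) :: real ^ 'm) * w +
        norm (transpose \<alpha> *v of_int_vec (y j) + of_int_vec (x j)) * t"
      unfolding t_def w_def using Pj by (intro not_near_int_lower_bound j1(1)) (simp add: P_def)
    also have "\<dots> \<le> R j * w + R (Suc j) powr - b * t"
      using y[of j] x[of j] t by (intro add_mono mult_right_mono) (auto simp: w_def)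
    also have "\<dots> \<le> R j * w + \<delta> j / 2" using Pj by (simp add: P_def)
    finally have wj: "\<delta> j / 2 / R j \<le> w" using R2[of j] by (simp add: field_simps)
    show "d * t powr - (real CARD('n) / real CARD('m)) \<le> w"
    proof (cases "j = j1")
      case True
      have "t powr - (1 / a) \<le> 1"
        using t a(1) by (simp add: powr_minus inverse_le_1_iff ge_one_powr_ge_zero)
      then have "d * t powr - (1 / a) \<le> d * 1" using d by (intro mult_left_mono) auto
      also have "\<dots> \<le> \<delta> j / 2 / R j" by (simp add: d_def True)
      finally show ?thesis using wj a(2) by simp
    next
      case False
      then obtain i where i: "j = Suc i" "i \<ge> j1" using Pj by (cases j) (auto simp: P_def)
      have "\<not> P i" using not_less_Least[of i P] i(1) by (simp add: j_def)
      then have "\<delta> i / 2 < R j powr - b * t" using i by (simp add: P_def)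
      moreover have "\<delta> j \<le> \<delta> i" using \<delta>(2)[of i] i(1) by simp
      ultimately have "\<delta> j / 2 \<le> R j powr - b * t" by linarith
      then have "R j powr b * (\<delta> j / 2) \<le> R j powr b * (R j powr - b * t)"
        by (intro mult_left_mono) auto
      also have "\<dots> = t"
      proof -
        have "R j powr b * R j powr - b = 1"
          using R2[of j] by (simp flip: powr_add)
        then show ?thesis by (simp flip: mult.assoc)
      qed
      finally have "(R j powr b * (\<delta> j / 2)) powr (1 / a) \<le> t powr (1 / a)"
        using a(1) \<delta>(1)[of j] by (intro powr_mono2) auto
      \<comment> \<open>Multiplies the lower bound for \<open>w\<close> by the one for
        \<open>t powr (1 / a)\<close>; the powers of \<open>R j\<close> combine to the exponent
        \<open>b / a - 1\<close>.\<close>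
      then have "(\<delta> j / 2 / R j) * ((R j powr b * (\<delta> j / 2)) powr (1 / a)) \<le> w * t powr (1 / a)"
        using wj \<delta>(1)[of j] R2[of j] by (intro mult_mono) (auto simp: w_def)
      moreover have "(\<delta> j / 2 / R j) * ((R j powr b * (\<delta> j / 2)) powr (1 / a)) =
          (\<delta> j / 2 * R j powr \<kappa>) powr (1 + 1 / a)"
      proof -
        have "(\<delta> j / 2 * R j powr \<kappa>) powr (1 + 1 / a) = (\<delta> j / 2) powr (1 + 1 / a) * R j powr (b / a - 1)"
        proof -
          have "(\<delta> j / 2 * R j powr \<kappa>) powr (1 + 1 / a) =
              (\<delta> j / 2) powr (1 + 1 / a) * (R j powr \<kappa>) powr (1 + 1 / a)"
            using \<delta>(1)[of j] by (intro powr_mult; simp)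
          then show ?thesis by (simp only: powr_powr \<kappa>(2))
        qed
        moreover have "(R j powr b * (\<delta> j / 2)) powr (1 / a) = R j powr (b / a) * (\<delta> j / 2) powr (1 / a)"
        proof -
          have "(R j powr b * (\<delta> j / 2)) powr (1 / a) = (R j powr b) powr (1 / a) * (\<delta> j / 2) powr (1 / a)"
            using \<delta>(1)[of j] by (intro powr_mult; simp)
          then show ?thesis by (simp add: powr_powr)
        qed
        moreover have "(\<delta> j / 2) powr (1 + 1 / a) = (\<delta> j / 2) * (\<delta> j / 2) powr (1 / a)"
          using \<delta>(1)[of j] by (simp add: powr_add)
        moreover have "R j powr (b / a - 1) = R j powr (b / a) / R j"
          using R2[of j] by (simp add: powr_diff)
        ultimately show ?thesis by simp
      qed
      moreover have "1 \<le> (\<delta> j / 2 * R j powr \<kappa>) powr (1 + 1 / a)"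
      proof (rule ge_one_powr_ge_zero)
        have "2 / \<delta> j \<le> R j powr \<kappa>" using j1(2) i by simp
        then show "1 \<le> \<delta> j / 2 * R j powr \<kappa>" using \<delta>(1)[of j] by (simp add: field_simps)
      qed (use pos in simp)
      ultimately have "1 \<le> w * t powr (1 / a)" by linarith
      then have "t powr - (1 / a) \<le> w" using t by (simp add: powr_minus field_simps)
      moreover have "d * t powr - (1 / a) \<le> 1 * t powr - (1 / a)"
        by (intro mult_right_mono) (auto simp: d_def)
      ultimately show ?thesis using a(2) by simp
    qed
  qed
qed

section \<open>Borel--Cantelli in a nondegenerate chart\<close>

text \<open>The best approximation sequence exists only when the transpose of \<alpha> admits no
  exact integer relation, hence the case distinction. Exact relations are handled directly, with a
  single \<open>y\<close>.\<close>

lemma negligible_not_badly_approximable_on_ball: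
  fixes \<alpha> :: "real ^ 'n ^ 'm" and g :: "real ^ 'd \<Rightarrow> real ^ 'm"
  assumes sing: "very_singular \<alpha>" and cont: "continuous_on (ball x0 r) g"
    and N0: "N0 > 0" and c: "c > 0"
    and small: "\<And>y \<rho>. N0 \<le> norm y \<Longrightarrow> 0 < \<rho> \<Longrightarrow> \<rho> \<le> 1 \<Longrightarrow>
      measure lebesgue {x \<in> ball x0 r. near_int (c * \<rho> ^ s) (y \<bullet> g x)} < \<rho>"
  shows "negligible {x \<in> ball x0 r. g x \<notin> badly_approximable \<alpha>}"
proof -
  define A where "A \<delta> y = {x \<in> ball x0 r. near_int \<delta> (of_int_vec y \<bullet> g x)}" for \<delta> y
  have A: "A \<delta> y \<in> lmeasurable" for \<delta> y
    unfolding A_def by (intro lmeasurable_near_int_sublevel continuous_intros cont)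
  show ?thesis
  proof (cases "\<exists>(y :: int ^ 'm) (x :: int ^ 'n). y \<noteq> 0 \<and> transpose \<alpha> *v of_int_vec y + of_int_vec x = 0")
    case True
    then obtain y :: "int ^ 'm" and x :: "int ^ 'n"
      where yx: "y \<noteq> 0" "transpose \<alpha> *v of_int_vec y + of_int_vec x = 0" by blast
    \<comment> \<open>A multiple of the relation is again a relation; the factor \<open>k\<close>
      lifts its norm above the threshold \<open>N0\<close>.\<close>
    define k where "k = \<lceil>N0\<rceil>"
    have k: "real_of_int k \<ge> N0" "k > 0" using N0 by (auto simp: k_def)
    define y' x' where "y' = (\<chi> i. k * y $ i)" and "x' = (\<chi> i. k * x $ i)"
    have ov: "of_int_vec y' = real_of_int k *\<^sub>R of_int_vec y" "of_int_vec x' = real_of_int k *\<^sub>R of_int_vec x"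
      by (simp_all add: y'_def x'_def vec_eq_iff)
    have y'0: "y' \<noteq> 0" using yx(1) k(2) by (simp add: y'_def vec_eq_iff)
    have rel: "transpose \<alpha> *v of_int_vec y' + of_int_vec x' = 0"
      using yx(2) by (simp add: ov matrix_vector_mult_scaleR flip: scaleR_add_right)
    have "N0 * 1 \<le> real_of_int k * norm (of_int_vec y :: real ^ 'm)"
      using k N0 norm_of_int_vec_ge_1[OF yx(1)] by (intro mult_mono) auto
    then have ny': "N0 \<le> norm (of_int_vec y' :: real ^ 'm)" using k by (simp add: ov)
    show ?thesis
      unfolding negligible_outer
    proof (intro allI impI)
      fix e :: real assume e: "e > 0"
      define \<rho> where "\<rho> = min e 1"
      have \<rho>: "\<rho> > 0" "\<rho> \<le> 1" "\<rho> \<le> e" using e by (auto simp: \<rho>_def)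
      have "{x \<in> ball x0 r. g x \<notin> badly_approximable \<alpha>} \<subseteq> A (c * \<rho> ^ s) y'"
        using badly_approximable_if_exact_relation[OF y'0 rel, of "c * \<rho> ^ s"] c \<rho> by (auto simp: A_def)
      moreover have "measure lebesgue (A (c * \<rho> ^ s) y') < e"
        using small[OF ny' \<rho>(1,2)] \<rho>(3) unfolding A_def by linarith
      ultimately show "\<exists>T. {x \<in> ball x0 r. g x \<notin> badly_approximable \<alpha>} \<subseteq> T \<and> T \<in> lmeasurable \<and> measure lebesgue T < e"
        using A by blast
    qed
  next
    case False
    define a where "a = real CARD('m) / real CARD('n)"
    have a: "a > 0" by (simp add: a_def)
    obtain e where e: "e > 0" and ev: "\<forall>\<^sub>F A in at_top. \<exists>(y :: int ^ 'm) (x :: int ^ 'n). y \<noteq> 0 \<and>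
        norm (of_int_vec y) \<le> A \<and> norm (transpose \<alpha> *v of_int_vec y + of_int_vec x) \<le> A powr - (a + e)"
      using very_singular_transpose[OF sing] unfolding a_def by blast
    have nz: "\<And>(y :: int ^ 'm) (x :: int ^ 'n). y \<noteq> 0 \<Longrightarrow> transpose \<alpha> *v of_int_vec y + of_int_vec x \<noteq> 0"
      using False by blast
    obtain b \<nu> R and y :: "nat \<Rightarrow> int ^ 'm" and x :: "nat \<Rightarrow> int ^ 'n"
      where b: "b > a" and \<nu>: "\<nu> > 1" and R0: "R 0 \<ge> 2" and seq: "\<forall>j. R j powr \<nu> \<le> R (Suc j) \<and>
        norm (of_int_vec (y j)) \<le> R j \<and> R j < norm (of_int_vec (y (Suc j))) \<and>
        norm (transpose \<alpha> *v of_int_vec (y j) + of_int_vec (x j)) \<le> R (Suc j) powr - b"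
      using best_approximation_sequence[OF a e ev nz] by blast
    have Rstep: "\<And>j. R j powr \<nu> \<le> R (Suc j)" using seq by blast
    \<comment> \<open>\<open>small\<close> is used with \<open>\<rho> = (1 / 2) ^ j\<close>, for
      which the measures are summable and the tolerance \<open>c * \<rho> ^ s\<close> is geometric
      in \<open>j\<close>.\<close>
    define \<theta> :: real where "\<theta> = (1 / 2) ^ s"
    have \<theta>: "0 < \<theta>" "\<theta> \<le> 1" by (auto simp: \<theta>_def power_le_one)
    have \<theta>j: "c * \<theta> ^ j = c * ((1 / 2) ^ j) ^ s" for j
      by (simp add: \<theta>_def power_commutes mult.commute flip: power_mult)
    have "\<forall>\<^sub>F j in sequentially. N0 * 1 ^ j \<le> R j powr 1"
      using N0 by (intro double_exponential_growth[OF R0 \<nu> Rstep]) auto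
    then obtain J where J: "\<And>j. j \<ge> J \<Longrightarrow> N0 \<le> R j powr 1" unfolding eventually_sequentially by auto
    have RN: "N0 \<le> R j" if "j \<ge> J" for j
    proof -
      have "R j \<ge> 0"
        using R0 seq by (cases j) (auto intro: order_trans[OF powr_ge_zero])
      then show ?thesis using J[OF that] by simp
    qed
    \<comment> \<open>The shift is \<open>Suc J\<close> rather than \<open>J\<close> because the
      norm of \<open>y (Suc i)\<close> is bounded below by \<open>R i\<close>, so the threshold
      \<open>N0\<close> is reached one index later.\<close>
    define E where "E j = A (c * \<theta> ^ (j + Suc J)) (y (j + Suc J))" for j
    have mE: "measure lebesgue (E j) \<le> (1 / 2) ^ j" for j
    proof -
      have "N0 \<le> R (j + J)" by (rule RN) simp
      also have "\<dots> \<le> norm (of_int_vec (y (j + Suc J)) :: real ^ 'm)" using seq by (simp add: less_imp_le)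
      finally have "measure lebesgue (E j) < (1 / 2) ^ (j + Suc J)"
        unfolding E_def A_def \<theta>j by (intro small) (auto simp: power_le_one simp del: power_Suc add_Suc_right)
      also have "\<dots> \<le> (1 / 2 :: real) ^ j" by (rule power_decreasing) auto
      finally show ?thesis by simp
    qed
    have "limsup E \<in> null_sets lebesgue"
    proof (rule borel_cantelli_limsup1)
      show "E j \<in> sets lebesgue" "emeasure lebesgue (E j) < \<infinity>" for j
        using A[of "c * \<theta> ^ (j + Suc J)" "y (j + Suc J)"] by (auto simp: E_def fmeasurable_def)
      show "summable (\<lambda>j. measure lebesgue (E j))"
        by (rule summable_comparison_test'[of "\<lambda>j. (1 / 2) ^ j" 0]) (use mE in auto)
    qed
    then have "negligible (limsup E)" by (simp add: negligible_iff_null_sets)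
    moreover have "{x \<in> ball x0 r. g x \<notin> badly_approximable \<alpha>} \<subseteq> limsup E"
    proof clarify
      fix z assume z: "z \<in> ball x0 r" "g z \<notin> badly_approximable \<alpha>"
      have "\<not> (\<forall>\<^sub>F j in sequentially. \<not> near_int (c * \<theta> ^ j) (of_int_vec (y j) \<bullet> g z))"
        using badly_approximable_if_eventually_not_near_int[of b R \<nu> y \<alpha> x c \<theta> "g z"]
          b R0 \<nu> seq c \<theta> z(2) unfolding a_def by blast
      then have "\<not> (\<forall>\<^sub>F j in sequentially. \<not> near_int (c * \<theta> ^ (j + Suc J)) (of_int_vec (y (j + Suc J)) \<bullet> g z))"
        using eventually_sequentially_seg[of "\<lambda>j. \<not> near_int (c * \<theta> ^ j) (of_int_vec (y j) \<bullet> g z)" "Suc J"] by simp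
      then have "\<not> (\<forall>\<^sub>F j in sequentially. z \<notin> E j)"
        using z(1) by (simp add: E_def A_def)
      then show "z \<in> limsup E"
        by (auto simp: limsup_INF_SUP eventually_sequentially)
    qed
    ultimately show ?thesis by (rule negligible_subset)
  qed
qed

section \<open>Change of charts\<close>

text \<open>On the segment from the identity to the Gram matrix all matrices are positive definite,
  so the determinant does not vanish and keeps its sign.\<close>

lemma det_gram_pos:
  fixes J :: "real ^ 'd ^ 'm"
  assumes "inj ((*v) J)"
  shows "det (transpose J ** J) > 0"
proof -
  define P :: "real \<Rightarrow> real ^ 'd ^ 'd" where "P t = t *\<^sub>R (transpose J ** J) + (1 - t) *\<^sub>R mat 1" for t
  have nz: "det (P t) \<noteq> 0" if t: "0 \<le> t" "t \<le> 1" for t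
  proof -
    have "v = 0" if "P t *v v = 0" for v
    proof (rule ccontr)
      assume v: "v \<noteq> 0"
      have "P t *v v = t *\<^sub>R (transpose J *v (J *v v)) + (1 - t) *\<^sub>R v"
        by (simp add: P_def matrix_vector_mult_add_rdistrib scaleR_matrix_vector_assoc[symmetric] matrix_vector_mul_assoc)
      moreover have "v \<bullet> (transpose J *v (J *v v)) = (J *v v) \<bullet> (J *v v)"
        by (metis dot_lmul_matrix inner_commute transpose_matrix_vector)
      ultimately have "v \<bullet> (P t *v v) = t * ((J *v v) \<bullet> (J *v v)) + (1 - t) * (v \<bullet> v)"
        by (simp add: inner_add_right)
      moreover have "(J *v v) \<bullet> (J *v v) > 0"
        using assms v by (metis inj_eq inner_gt_zero_iff matrix_vector_mult_0_right)
      moreover have "v \<bullet> v > 0" using v by simp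
      ultimately have "v \<bullet> (P t *v v) > 0"
        using t by (cases "t = 0") (auto intro!: add_pos_nonneg)
      then show False using that by simp
    qed
    then have "invertible (P t)"
      unfolding invertible_left_inverse matrix_left_invertible_ker by blast
    then show ?thesis by (simp add: invertible_det_nz)
  qed
  have cont: "continuous_on {0..1} (\<lambda>t. det (P t))"
    unfolding det_def P_def by (simp add: continuous_intros)
  have P0: "det (P 0) = 1" and P1: "P 1 = transpose J ** J" by (simp_all add: P_def)
  show ?thesis
  proof (rule ccontr)
    assume "\<not> ?thesis"
    then have "det (P 1) \<le> 0" by (simp add: P1)
    then obtain t where "0 \<le> t" "t \<le> 1" "det (P t) = 0"
      using IVT2'[of "\<lambda>t. det (P t)" 1 0 0] cont P0 by auto
    then show False using nz by blast
  qed
qed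

text \<open>The derivative is a pointwise limit of difference quotients with steps
  \<open>1 / Suc n\<close>. Extending \<open>f\<close> by 0 makes these Borel on the whole space; as
  \<open>U\<close> is open, the extension does not affect the limit.\<close>

lemma borel_measurable_frechet_derivative_component:
  fixes f :: "'a::euclidean_space \<Rightarrow> real"
  assumes "open U" "\<And>x. x \<in> U \<Longrightarrow> (f has_derivative f' x) (at x)"
  shows "(\<lambda>x. f' x v) \<in> borel_measurable (lebesgue_on U)"
proof -
  define F where "F x = (if x \<in> U then f x else 0)" for x
  have "continuous_on U f"
    by (rule has_derivative_continuous_on[of U f f'], rule has_derivative_at_withinI, rule assms(2))
  then have F [measurable]: "F \<in> borel_measurable borel"
    unfolding F_def using assms(1) by (intro borel_measurable_continuous_on_if) auto
  have "(\<lambda>x. real (Suc n) * (F (x + (1 / real (Suc n)) *\<^sub>R v) - F x)) \<in> borel_measurable (lebesgue_on U)" for n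
  proof -
    have "(\<lambda>x. real (Suc n) * (F (x + (1 / real (Suc n)) *\<^sub>R v) - F x)) \<in> borel_measurable borel"
      by measurable
    then show ?thesis
      by (intro measurable_restrict_space1 measurable_completion) simp
  qed
  moreover have "(\<lambda>n. real (Suc n) * (F (x + (1 / real (Suc n)) *\<^sub>R v) - F x)) \<longlonglongrightarrow> f' x v"
    if x: "x \<in> space (lebesgue_on U)" for x
  proof -
    have xU: "x \<in> U" using x by simp
    have "(f has_derivative f' x) (at x)" by (rule assms(2)[OF xU])
    then have "((\<lambda>t. f (x + t *\<^sub>R v)) has_derivative (\<lambda>t. f' x (t *\<^sub>R v))) (at 0)"
      by (intro has_derivative_compose[of "\<lambda>t. x + t *\<^sub>R v" _ 0 UNIV f, simplified]) (auto intro!: derivative_eq_intros)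
    moreover have "f' x (t *\<^sub>R v) = t * f' x v" for t
      using \<open>(f has_derivative f' x) (at x)\<close> by (simp add: has_derivative_def linear_simps)
    ultimately have "((\<lambda>t. f (x + t *\<^sub>R v)) has_real_derivative f' x v) (at 0)"
      by (simp add: has_field_derivative_def mult.commute[of _ "f' x v"])
    then have "((\<lambda>h. (f (x + h *\<^sub>R v) - f x) / h) \<longlongrightarrow> f' x v) (at 0)"
      by (simp add: DERIV_def)
    moreover have "filterlim (\<lambda>n. 1 / real (Suc n)) (at 0) sequentially"
      by (intro filterlim_atI LIMSEQ_Suc[OF lim_1_over_n]) auto
    ultimately have "(\<lambda>n. (f (x + (1 / real (Suc n)) *\<^sub>R v) - f x) / (1 / real (Suc n))) \<longlonglongrightarrow> f' x v"
      by (rule filterlim_compose)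
    moreover have "\<forall>\<^sub>F n in sequentially. x + (1 / real (Suc n)) *\<^sub>R v \<in> U"
    proof -
      have "(\<lambda>n. x + (1 / real (Suc n)) *\<^sub>R v) \<longlonglongrightarrow> x + 0 *\<^sub>R v"
        by (intro tendsto_intros LIMSEQ_Suc[OF lim_1_over_n])
      then show ?thesis using assms(1) xU by (simp add: topological_tendstoD)
    qed
    then have "\<forall>\<^sub>F n in sequentially. (f (x + (1 / real (Suc n)) *\<^sub>R v) - f x) / (1 / real (Suc n)) =
        real (Suc n) * (F (x + (1 / real (Suc n)) *\<^sub>R v) - F x)"
      by eventually_elim (use xU in \<open>simp add: F_def\<close>)
    ultimately show ?thesis by (rule Lim_transform_eventually)
  qed
  ultimately show ?thesis by (rule borel_measurable_LIMSEQ_real[rotated])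
qed

text \<open>Injectivity of the derivative makes the volume density nonzero at every point of
  \<open>U\<close>, so it changes no null sets.\<close>

lemma null_sets_parametrized_volume_iff:
  fixes f :: "real ^ 'd::finite \<Rightarrow> real ^ 'm"
  assumes f: "local_parametrization M U f" and A: "A \<subseteq> U"
  shows "A \<in> null_sets (parametrized_volume U f) \<longleftrightarrow> negligible A"
proof -
  have U: "open U" using f by (simp add: local_parametrization_def)
  obtain f' where f': "\<And>x. x \<in> U \<Longrightarrow> (f has_derivative f' x) (at x)" "\<And>x. x \<in> U \<Longrightarrow> inj (f' x)"
    using f unfolding local_parametrization_def by metis
  define J where "J x = jacobian f (at x)" for x
  have J: "J x = matrix (f' x)" if "x \<in> U" for x
    using frechet_derivative_at[OF f'(1)[OF that]] by (simp add: J_def jacobian_def)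
  define \<delta> where "\<delta> x = ennreal (sqrt (det (transpose (J x) ** J x)))" for x
  have comp: "(\<lambda>x. J x $ k $ i) \<in> borel_measurable (lebesgue_on U)" for k i
  proof -
    have "(\<lambda>x. f' x (axis i 1) $ k) \<in> borel_measurable (lebesgue_on U)"
      by (rule borel_measurable_frechet_derivative_component[OF U, of "\<lambda>x. f x $ k" "\<lambda>x v. f' x v $ k"])
        (intro bounded_linear.has_derivative[OF bounded_linear_vec_nth] f')
    then show ?thesis
      by (rule measurable_cong[THEN iffD1, rotated]) (simp add: J matrix_def)
  qed
  have \<delta>meas: "\<delta> \<in> borel_measurable (lebesgue_on U)"
  proof -
    have "(\<lambda>x. det (transpose (J x) ** J x)) \<in> borel_measurable (lebesgue_on U)"
      unfolding det_def matrix_matrix_mult_def transpose_def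
      by (simp, intro borel_measurable_sum borel_measurable_times borel_measurable_prod borel_measurable_const comp)
    then show ?thesis unfolding \<delta>_def by measurable
  qed
  have \<delta>pos: "\<delta> x \<noteq> 0" if "x \<in> U" for x
  proof -
    have "(*v) (J x) = f' x"
      using f'(1)[OF that] J[OF that] by (auto simp: has_derivative_def bounded_linear.linear intro!: ext matrix_works)
    then have "det (transpose (J x) ** J x) > 0" using f'(2)[OF that] by (intro det_gram_pos) simp
    then show ?thesis by (simp add: \<delta>_def ennreal_eq_0_iff)
  qed
  have "A \<in> null_sets (parametrized_volume U f) \<longleftrightarrow>
      A \<in> sets (lebesgue_on U) \<and> (AE x in lebesgue_on U. x \<in> A \<longrightarrow> \<delta> x = 0)"
    unfolding parametrized_volume_def J_def[symmetric] \<delta>_def[symmetric]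
    by (rule null_sets_density_iff[OF \<delta>meas])
  also have "\<dots> \<longleftrightarrow> A \<in> sets (lebesgue_on U) \<and> (AE x in lebesgue_on U. x \<notin> A)"
    by (intro conj_cong refl AE_cong) (use \<delta>pos in auto)
  also have "\<dots> \<longleftrightarrow> A \<in> null_sets (lebesgue_on U)"
    by (metis AE_iff_null_sets null_setsD2)
  also have "\<dots> \<longleftrightarrow> negligible A"
    using U A by (simp add: null_sets_restrict_space negligible_iff_null_sets)
  finally show ?thesis .
qed

text \<open>Both sides of \<open>f (\<psi> w) = g w\<close> are expanded at \<open>z\<close>, and a
  left inverse \<open>L\<close> of \<open>f'\<close> isolates the increment of \<psi>. Continuity
  brings \<open>\<psi> w\<close> into the range where the expansion of \<open>f\<close> is valid.
  \<open>S\<close> is arbitrary, so the derivative is taken within \<open>S\<close>.\<close>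

lemma chart_transition_differentiable:
  fixes f :: "'a::euclidean_space \<Rightarrow> 'b::euclidean_space" and g :: "'c::euclidean_space \<Rightarrow> 'b"
  assumes f: "(f has_derivative f') (at (\<psi> z))" "inj f'"
    and g: "(g has_derivative g') (at z)" and z: "z \<in> S"
    and eq: "\<And>w. w \<in> S \<Longrightarrow> f (\<psi> w) = g w"
    and cont: "continuous (at z within S) \<psi>"
  shows "\<psi> differentiable (at z within S)"
proof -
  have linf: "linear f'" and bg: "bounded_linear g'"
    using f(1) g by (auto simp: has_derivative_def bounded_linear.linear)
  obtain L where L: "linear L" "L \<circ> f' = id" using linear_injective_left_inverse[OF linf f(2)] by blast
  have bL: "bounded_linear L" using L(1) by (simp add: linear_conv_bounded_linear)
  obtain B where B: "B > 0" "\<And>v. norm (L v) \<le> norm v * B" using bounded_linear.pos_bounded[OF bL] by blast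
  obtain G where G: "G > 0" "\<And>v. norm (g' v) \<le> norm v * G" using bounded_linear.pos_bounded[OF bg] by blast
  have "(\<psi> has_derivative (L \<circ> g')) (at z within S)"
    unfolding has_derivative_within_alt
  proof (intro conjI allI impI)
    show "bounded_linear (L \<circ> g')" unfolding o_def by (rule bounded_linear_compose[OF bL bg])
    fix e :: real assume e: "e > 0"
    \<comment> \<open>The bounds \<open>1\<close> and \<open>1 / (2 * B)\<close> yield the a priori
      estimate \<open>norm u \<le> 2 * B * (G + 1) * h\<close>, half of \<open>norm u\<close> being
      absorbed; the other bounds then make each remainder at most \<open>e / 2 * h\<close>.\<close>
    define e2 where "e2 = min 1 (e / (2 * B))"
    define e1 where "e1 = min (1 / (2 * B)) (e / (4 * B * B * (G + 1)))"
    have e12: "e1 > 0" "e2 > 0" using e B G by (auto simp: e1_def e2_def)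
    obtain d1 where d1: "d1 > 0" "\<And>u. norm (u - \<psi> z) < d1 \<Longrightarrow>
        norm (f u - f (\<psi> z) - f' (u - \<psi> z)) \<le> e1 * norm (u - \<psi> z)"
      using f(1) e12(1) unfolding has_derivative_at_alt by blast
    obtain d2 where d2: "d2 > 0" "\<And>w. norm (w - z) < d2 \<Longrightarrow>
        norm (g w - g z - g' (w - z)) \<le> e2 * norm (w - z)"
      using g e12(2) unfolding has_derivative_at_alt by blast
    obtain d3 where d3: "d3 > 0" "\<And>w. w \<in> S \<Longrightarrow> dist w z < d3 \<Longrightarrow> dist (\<psi> w) (\<psi> z) < d1"
      using cont d1(1) unfolding continuous_within_eps_delta by blast
    show "\<exists>d>0. \<forall>w\<in>S. norm (w - z) < d \<longrightarrow> norm (\<psi> w - \<psi> z - (L \<circ> g') (w - z)) \<le> e * norm (w - z)"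
    proof (intro exI[of _ "min d2 d3"] conjI ballI impI)
      show "min d2 d3 > 0" using d2 d3 by simp
      fix w assume w: "w \<in> S" "norm (w - z) < min d2 d3"
      define u where "u = \<psi> w - \<psi> z"
      define h where "h = norm (w - z)"
      define r1 where "r1 = f (\<psi> w) - f (\<psi> z) - f' u"
      define r2 where "r2 = g w - g z - g' (w - z)"
      have r1: "norm r1 \<le> e1 * norm u"
        using d1(2)[of "\<psi> w"] d3(2)[OF w(1)] w(2) by (simp add: r1_def u_def dist_norm)
      have r2: "norm r2 \<le> e2 * h" using d2(2)[of w] w(2) by (simp add: r2_def h_def)
      have "u = L (f' u)" using L(2) by (metis comp_apply id_apply)
      also have "f' u = g' (w - z) + r2 - r1" using eq w(1) z by (simp add: r1_def r2_def)
      finally have u: "u = L (g' (w - z)) + L r2 - L r1"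
        using L(1) by (simp add: linear_add linear_diff)
      have Lr1: "norm (L r1) \<le> B * e1 * norm u"
      proof -
        have "norm r1 * B \<le> e1 * norm u * B" using r1 B by (intro mult_right_mono) auto
        then show ?thesis using B(2)[of r1] by (simp add: mult_ac)
      qed
      have Lr2: "norm (L r2) \<le> B * e2 * h"
      proof -
        have "norm r2 * B \<le> e2 * h * B" using r2 B by (intro mult_right_mono) auto
        then show ?thesis using B(2)[of r2] by (simp add: mult_ac)
      qed
      have Lg: "norm (L (g' (w - z))) \<le> B * G * h"
      proof -
        have "norm (g' (w - z)) * B \<le> h * G * B"
          using G(2)[of "w - z"] B by (intro mult_right_mono) (auto simp: h_def)
        then show ?thesis using B(2)[of "g' (w - z)"] by (simp add: mult_ac)
      qed
      have "norm u \<le> norm (L (g' (w - z))) + norm (L r2) + norm (L r1)"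
        unfolding u by (meson norm_triangle_ineq norm_triangle_ineq4 add_mono order_refl order_trans)
      moreover have "B * e1 * norm u \<le> 1 / 2 * norm u"
      proof (rule mult_right_mono)
        have "e1 \<le> 1 / (2 * B)" by (simp add: e1_def)
        then show "B * e1 \<le> 1 / 2" using B by (simp add: field_simps)
      qed simp
      moreover have "B * e2 * h \<le> B * 1 * h"
        using B by (intro mult_right_mono mult_left_mono) (auto simp: e2_def h_def)
      ultimately have nu: "norm u \<le> 2 * B * (G + 1) * h"
        using Lg Lr1 Lr2 by (simp add: algebra_simps)
      have "norm (L r1) \<le> e / 2 * h"
      proof -
        have "B * e1 * norm u \<le> B * e1 * (2 * B * (G + 1) * h)"
          using nu B e12 by (intro mult_left_mono) auto
        also have "\<dots> \<le> B * (e / (4 * B * B * (G + 1))) * (2 * B * (G + 1) * h)"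
          using B G by (intro mult_right_mono mult_left_mono) (auto simp: e1_def h_def)
        also have "\<dots> = e / 2 * h"
        proof -
          have "B * (e / (4 * B * B * D)) * (2 * B * D * h) = e / 2 * h" if "D > 0" for D
            using B that by simp
          then show ?thesis using G by simp
        qed
        finally show ?thesis using Lr1 by linarith
      qed
      moreover have "norm (L r2) \<le> e / 2 * h"
      proof -
        have "B * e2 * h \<le> B * (e / (2 * B)) * h"
          using B by (intro mult_right_mono mult_left_mono) (auto simp: e2_def h_def)
        also have "\<dots> = e / 2 * h" using B by simp
        finally show ?thesis using Lr2 by linarith
      qed
      moreover have "\<psi> w - \<psi> z - (L \<circ> g') (w - z) = L r2 - L r1" using u by (simp add: u_def)
      ultimately show "norm (\<psi> w - \<psi> z - (L \<circ> g') (w - z)) \<le> e * norm (w - z)"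
        using norm_triangle_ineq4[of "L r2" "L r1"] unfolding h_def by simp
    qed
  qed
  then show ?thesis unfolding differentiable_def by blast
qed

section \<open>Passage from nondegenerate charts to an arbitrary chart\<close>

theorem theorem1p5:
  fixes \<alpha> :: "real ^ 'n ^ 'm" and M :: "(real ^ 'm) set"
  assumes "CARD('m) \<ge> 2"
    and "very_singular \<alpha>"
    and "analytic_submanifold TYPE('d::finite) M"
    and "nondegenerate TYPE('d) M"
  shows "null_in_manifold TYPE('d) M (M - badly_approximable \<alpha>)"
  unfolding null_in_manifold_def
proof (intro allI impI)
  fix U :: "(real ^ 'd) set" and f
  assume f: "local_parametrization M U f"
  define E where "E = {x \<in> U. f x \<in> M - badly_approximable \<alpha>}"
  define N where "N = {x \<in> U. f x \<in> {y \<in> M. \<not> nondegenerate_at TYPE('d) M y}}"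
  obtain finv where openU: "open U" and fU: "openin (top_of_set M) (f ` U)"
    and hom: "homeomorphism U (f ` U) f finv"
    and df: "\<And>x. x \<in> U \<Longrightarrow> \<exists>f'. (f has_derivative f') (at x) \<and> inj f'"
    using f unfolding local_parametrization_def by blast
  have "N \<in> null_sets (parametrized_volume U f)"
    using assms(4) f unfolding nondegenerate_def null_in_manifold_def N_def by blast
  then have "negligible N"
    using null_sets_parametrized_volume_iff[OF f, of N] by (auto simp: N_def)
  moreover have "negligible (E - N)"
  proof (rule locally_negligible_alt[THEN iffD2], rule ballI)
    fix x assume x: "x \<in> E - N"
    then have "nondegenerate_at TYPE('d) M (f x)" by (auto simp: E_def N_def)
    \<comment> \<open>The chart \<open>g\<close> witnessing nondegeneracy at \<open>f x\<close> need
      not be \<open>f\<close>: the bad set is shown negligible in \<open>g\<close> and then carried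
      over by the transition map.\<close>
    then obtain U' :: "(real ^ 'd) set" and g x' k V
      where g: "local_parametrization M U' g" and x': "x' \<in> U'" "g x' = f x"
        and V: "open V" "x' \<in> V" "V \<subseteq> U'" "Ck_on k g V"
        and span: "span {iterated_partial is g x' | is. 1 \<le> length is \<and> length is \<le> k} = UNIV"
      unfolding nondegenerate_at_def by blast
    obtain ginv where openU': "open U'" and gU': "openin (top_of_set M) (g ` U')"
      and homg: "homeomorphism U' (g ` U') g ginv"
      and dg: "\<And>z. z \<in> U' \<Longrightarrow> \<exists>g'. (g has_derivative g') (at z) \<and> inj g'"
      using g unfolding local_parametrization_def by blast
    obtain r N0 c s where r: "r > 0" "ball x' r \<subseteq> V" and c: "N0 > 0" "c > 0"
      and small: "\<forall>y \<rho>. N0 \<le> norm y \<longrightarrow> 0 < \<rho> \<longrightarrow> \<rho> \<le> 1 \<longrightarrow>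
        measure lebesgue {x \<in> ball x' r. near_int (c * \<rho> ^ s) (y \<bullet> g x)} < \<rho>"
      using nondegenerate_sublevel_measure[OF V(1,2,4) span] by blast
    have ballU': "ball x' r \<subseteq> U'" using r V by blast
    have contg: "continuous_on (ball x' r) g"
      using homg ballU' by (meson continuous_on_subset homeomorphism_cont1)
    have neg: "negligible {z \<in> ball x' r. g z \<notin> badly_approximable \<alpha>}"
      using small by (intro negligible_not_badly_approximable_on_ball[OF assms(2) contg c, of s]) auto
    \<comment> \<open>Only points whose image also lies in the chart \<open>f\<close> are kept,
      since \<open>finv\<close> inverts \<open>f\<close> only there.\<close>
    define S where "S = {z \<in> ball x' r. g z \<notin> badly_approximable \<alpha> \<and> g z \<in> f ` U}"
    have "negligible S" by (rule negligible_subset[OF neg]) (auto simp: S_def)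
    define \<psi> where "\<psi> = finv \<circ> g"
    have "continuous_on S \<psi>"
      unfolding \<psi>_def
    proof (rule continuous_on_compose)
      show "continuous_on S g" by (rule continuous_on_subset[OF contg]) (auto simp: S_def)
      show "continuous_on (g ` S) finv"
        by (rule continuous_on_subset[OF homeomorphism_cont2[OF hom]]) (auto simp: S_def)
    qed
    have f\<psi>: "f (\<psi> w) = g w" "\<psi> w \<in> U" if "w \<in> S" for w
      using that hom by (auto simp: \<psi>_def S_def homeomorphism_def)
    have "\<psi> differentiable_on S"
      unfolding differentiable_on_def
    proof
      fix z assume z: "z \<in> S"
      obtain f' where f': "(f has_derivative f') (at (\<psi> z))" "inj f'" using df f\<psi>(2)[OF z] by blast
      have "z \<in> U'" using z ballU' by (auto simp: S_def)
      then obtain g' where g': "(g has_derivative g') (at z)" using dg by blast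
      show "\<psi> differentiable (at z within S)"
        using \<open>continuous_on S \<psi>\<close> f' g' z f\<psi>(1)
        by (intro chart_transition_differentiable[where f = f and g = g])
          (auto simp: continuous_on_eq_continuous_within)
    qed
    then have neg\<psi>: "negligible (\<psi> ` S)"
      using \<open>negligible S\<close> by (intro negligible_differentiable_image_negligible) auto
    define W where "W = U \<inter> f -` (g ` ball x' r)"
    have "openin (top_of_set (g ` U')) (g ` ball x' r)"
      using ballU' by (intro homeomorphism_imp_open_map[OF homg] open_openin_trans) (auto simp: openU')
    then have "openin (top_of_set M) (g ` ball x' r)" using gU' openin_trans by blast
    moreover have "f ` U \<subseteq> M" using fU openin_imp_subset by blast
    ultimately have "openin (top_of_set U) W"
      unfolding W_def by (intro continuous_openin_preimage[OF homeomorphism_cont1[OF hom]]) auto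
    then have "open W" using openU openin_open_trans by blast
    show "\<exists>T. openin (top_of_set (E - N)) T \<and> x \<in> T \<and> negligible T"
    proof (intro exI[of _ "(E - N) \<inter> W"] conjI)
      show "openin (top_of_set (E - N)) ((E - N) \<inter> W)" using \<open>open W\<close> by (rule openin_open_Int)
      have "f x \<in> g ` ball x' r" using x'(2) r(1) by (metis centre_in_ball imageI)
      then show "x \<in> (E - N) \<inter> W" using x by (auto simp: W_def E_def)
      have "(E - N) \<inter> W \<subseteq> \<psi> ` S"
      proof
        fix v assume v: "v \<in> (E - N) \<inter> W"
        then obtain z where z: "z \<in> ball x' r" "f v = g z" by (auto simp: W_def)
        have "v \<in> U" using v by (simp add: W_def)
        then have "\<psi> z = v" using hom z(2) by (metis \<psi>_def comp_apply homeomorphism_apply1)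
        moreover have "z \<in> S" using z v \<open>v \<in> U\<close> by (force simp: S_def E_def)
        ultimately show "v \<in> \<psi> ` S" by blast
      qed
      then show "negligible ((E - N) \<inter> W)" by (rule negligible_subset[OF neg\<psi>])
    qed
  qed
  ultimately have "negligible E"
    by (rule negligible_subset[OF negligible_Un]) auto
  then show "{x \<in> U. f x \<in> M - badly_approximable \<alpha>} \<in> null_sets (parametrized_volume U f)"
    unfolding E_def[symmetric] by (subst null_sets_parametrized_volume_iff[OF f]) (auto simp: E_def)
qed

end
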